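(* Let $H=(H_t)_{t\in\mathbb{R}}$ be an extended chronometer satisfying $\mathbb{P}(\lim_{t\to-\infty}H_t=0)=1$ and $\mathbb{P}(H_t=\infty)<1$ for all $t\in\mathbb{R}$. Then there exist a Lévy measure $\nu$ on $$M^0_\infty:=\{x\in D^\infty(\mathbb{R})\mid x\text{ is non-decreasing},\ \lim_{t\to-\infty}x(t)=0\}$$ and a function $b\in M^0_\infty\cap D(\mathbb{R})$ such that for all $d\in\mathbb{N}$, $\mathbf{z}\in[0,\infty)^d$ and $\mathbf{t}\in\mathbb{R}^d$, $$\mathbb{E}\Big[e^{-\sum_{i=1}^dz_iH_{t_i}}\Big]=\exp\Big(-\sum_{i=1}^dz_ib(t_i)-\int_{M^0_\infty}\Big(1-e^{-\sum_{i=1}^dz_ix(t_i)}\Big)\nu(\mathrm{d}x)\Big).$$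
   Context: $D(\mathbb{R})$ (resp. $D^\infty(\mathbb{R})$) is the space of real-valued (resp. $[-\infty,\infty]$-valued) càdlàg functions on $\mathbb{R}$, with the $\sigma$-algebra generated by finite-dimensional projections. Conventions: $0\cdot\infty=0$, $e^{-\infty}=0$. A process $(H_t)_{t\in\mathbb{R}}$ with values in $[-\infty,\infty]$, such that for each $t$ either $\mathbb{P}(H_t=\infty)=0$ or $\mathbb{P}(H_t=-\infty)=0$, is infinitely divisible (id) if for every $n\in\mathbb{N}$ there are i.i.d. processes $H^{(1,1/n)},\ldots,H^{(n,1/n)}$ indexed by $\mathbb{R}$ with $H\sim\sum_{i=1}^nH^{(i,1/n)}$ (equality of finite-dimensional distributions). An extended chronometer is a non-negative, non-decreasing id-process with paths in $D^\infty(\mathbb{R})$. A Lévy measure is a measure $\nu$ on $D^\infty(\mathbb{R})$ (here concentrated on $M^0_\infty$) with $\nu(\{0\})=0$, where $0$ denotes the zero function, and $\int\min\{x(t),1\}\,\nu(\mathrm{d}x)<\infty$ for all $t\in\mathbb{R}$. The function $b$ and the measure $\nu$ are the drift and the Lévy measure of $H$. *)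

theory Defs
  imports "HOL-Probability.Probability"
begin

definition cadlag :: "(real \<Rightarrow> 'a::topological_space) \<Rightarrow> bool" where
  "cadlag f \<longleftrightarrow> (\<forall>t. (f \<longlongrightarrow> f t) (at_right t) \<and> (\<exists>l. (f \<longlongrightarrow> l) (at_left t)))"

definition D_real :: "(real \<Rightarrow> real) set" where
  "D_real = {f. cadlag f}"

definition D_inf :: "(real \<Rightarrow> ereal) set" where
  "D_inf = {f. cadlag f}"

text \<open>The trace on \<open>D_inf\<close> of the product sigma-algebra is the sigma-algebra generated by the
  finite-dimensional projections.\<close>

definition D_inf_algebra :: "(real \<Rightarrow> ereal) measure" where
  "D_inf_algebra = restrict_space (Pi\<^sub>M UNIV (\<lambda>_. borel)) D_inf"

definition M0_inf :: "(real \<Rightarrow> ereal) set" where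
  "M0_inf = {x \<in> D_inf. mono x \<and> (x \<longlongrightarrow> 0) at_bot}"

definition stoch_process :: "'a measure \<Rightarrow> (real \<Rightarrow> 'a \<Rightarrow> ereal) \<Rightarrow> bool" where
  "stoch_process M H \<longleftrightarrow> prob_space M \<and> (\<forall>t. H t \<in> borel_measurable M)"

definition same_fdd ::
  "'a measure \<Rightarrow> (real \<Rightarrow> 'a \<Rightarrow> ereal) \<Rightarrow> 'b measure \<Rightarrow> (real \<Rightarrow> 'b \<Rightarrow> ereal) \<Rightarrow> bool" where
  "same_fdd M X N Y \<longleftrightarrow> (\<forall>J. finite J \<longrightarrow>
     distr M (Pi\<^sub>M J (\<lambda>_. borel)) (\<lambda>\<omega>. \<lambda>t\<in>J. X t \<omega>) =
     distr N (Pi\<^sub>M J (\<lambda>_. borel)) (\<lambda>\<omega>. \<lambda>t\<in>J. Y t \<omega>))"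

definition iid_processes :: "'b measure \<Rightarrow> nat \<Rightarrow> (nat \<Rightarrow> real \<Rightarrow> 'b \<Rightarrow> ereal) \<Rightarrow> bool" where
  "iid_processes N n X \<longleftrightarrow>
     (\<forall>i<n. stoch_process N (X i)) \<and>
     prob_space.indep_vars N (\<lambda>_. Pi\<^sub>M UNIV (\<lambda>_. borel)) (\<lambda>i \<omega> t. X i t \<omega>) {..<n} \<and>
     (\<forall>i<n. \<forall>j<n. same_fdd N (X i) N (X j))"

text \<open>Taking the sample space of the summands of type \<^typ>\<open>nat \<Rightarrow> real \<Rightarrow> ereal\<close> is no restriction:
  the joint law of any sequence of processes lives on this type, with the coordinates as processes.
  The convention \<open>\<infinity> + (-\<infinity>) = \<infinity>\<close> of \<^typ>\<open>ereal\<close> is immaterial: if a summand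
  took both infinite values at time \<open>t\<close> with positive probability, then by independence so
  would the sum, contradicting the assumption on \<open>H t\<close>.\<close>

definition id_process :: "'a measure \<Rightarrow> (real \<Rightarrow> 'a \<Rightarrow> ereal) \<Rightarrow> bool" where
  "id_process M H \<longleftrightarrow>
     stoch_process M H \<and>
     (\<forall>t. measure M {\<omega> \<in> space M. H t \<omega> = \<infinity>} = 0 \<or>
          measure M {\<omega> \<in> space M. H t \<omega> = -\<infinity>} = 0) \<and>
     (\<forall>n>0. \<exists>(N :: (nat \<Rightarrow> real \<Rightarrow> ereal) measure) X.
        iid_processes N n X \<and> same_fdd M H N (\<lambda>t \<omega>. \<Sum>i<n. X i t \<omega>))"

text \<open>Properties of the paths are understood almost surely; sample-path-wise versions are a special
  case.\<close>

definition extended_chronometer :: "'a measure \<Rightarrow> (real \<Rightarrow> 'a \<Rightarrow> ereal) \<Rightarrow> bool" where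
  "extended_chronometer M H \<longleftrightarrow>
     id_process M H \<and>
     (AE \<omega> in M. (\<lambda>t. H t \<omega>) \<in> D_inf \<and> (\<forall>t. 0 \<le> H t \<omega>) \<and> mono (\<lambda>t. H t \<omega>))"

text \<open>\<^const>\<open>e2ennreal\<close> truncates negative values to 0, which plays no role because \<open>\<nu>\<close> is concentrated
  on non-negative functions.\<close>

definition levy_measure_on_M0_inf :: "(real \<Rightarrow> ereal) measure \<Rightarrow> bool" where
  "levy_measure_on_M0_inf \<nu> \<longleftrightarrow>
     sets \<nu> = sets D_inf_algebra \<and>
     (AE x in \<nu>. x \<in> M0_inf) \<and>
     {\<lambda>_. 0} \<in> null_sets \<nu> \<and>
     (\<forall>t. (\<integral>\<^sup>+ x. e2ennreal (min (x t) 1) \<partial>\<nu>) < \<infinity>)"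

text \<open>\<open>exp_minus y\<close> is \<open>e\<^sup>-\<^sup>y\<close> for \<open>y \<in> [0, \<infinity>]\<close>; its value at \<open>-\<infinity>\<close> is not meaningful.\<close>

definition exp_minus :: "ereal \<Rightarrow> real" where
  "exp_minus y = (if y = \<infinity> then 0 else exp (- real_of_ereal y))"

end

theory Submission
  imports Defs
begin

text \<open>Let \<open>Y\<^sub>n\<close> be an \<open>n\<close>-th convolution root of \<open>H\<close>, so that
  \<open>n E[1 - exp (-<z, Y\<^sub>n>)]\<close> tends to \<open>-ln E[exp (-<z, H>)]\<close>. With \<open>u\<^sub>k = 1 - exp (-Y\<^sub>n(q\<^sub>k))\<close>
  along a dense sequence of times, and with a weighted sum \<open>w\<close> of the \<open>u\<^sub>k\<close>, the law of the slopes
  \<open>(w, (u\<^sub>k / w)\<^sub>k)\<close> under the measure of density \<open>n w\<close> has bounded mass and lives on a compact product of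
  intervals, hence converges along a subsequence. The integrand, divided by \<open>w\<close>, is a continuous
  function of the slopes even at \<open>w = 0\<close>, where it becomes linear in \<open>z\<close>. In the limit, the part on
  \<open>w > 0\<close>, reweighted by \<open>1 / w\<close>, is the Levy measure, and the part on \<open>w = 0\<close> is the drift. Right
  continuity of \<open>H\<close> extends the formula from the dense sequence to all times.\<close>

section \<open>Random sequences in the unit cube\<close>

text \<open>The Levy measure may have infinite mass near the zero path, so the laws of the roots
  multiplied by \<open>n\<close> cannot be expected to converge as they stand. Weighting by
  \<open>w\<close> bounds their mass: an \<open>n\<close>-th root \<open>r\<close> of
  \<open>p\<close> satisfies \<open>n * (1 - r) \<le> - ln p\<close>, which is finite here because
  \<open>H t\<close> is not almost surely infinite. Passing from \<open>Y\<close> to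
  \<open>1 - exp (- Y)\<close> turns the value infinity into the ordinary point 1. Restricting to
  countably many times replaces an uncountable product by a cube whose points can be coded by single
  reals. The roots are known only through finite-dimensional laws and have no path regularity;
  right-continuous paths are rebuilt after the limit, as infima over later times. For one time and
  \<open>z = 1\<close> the kernel is the slope itself, whatever \<open>w\<close> is. Hence the mean
  slope at \<open>t\<close> is \<open>- ln E[exp (- H t)]\<close>, which tends to 0 as
  \<open>t\<close> tends to minus infinity. This is how the assumption at minus infinity reaches
  both the drift and the paths charged by the Levy measure.\<close>

fun ternary_digit :: "nat \<Rightarrow> real \<Rightarrow> real" where
  "ternary_digit 0 s = max 0 (min 1 (3 * s - 1))"
| "ternary_digit (Suc m) s = ternary_digit m (3 * s - 2 * max 0 (min 1 (3 * s - 1)))"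

fun binary_digit :: "nat \<Rightarrow> real \<Rightarrow> real" where
  "binary_digit 0 v = (if v \<ge> 1/2 then 1 else 0)"
| "binary_digit (Suc j) v = binary_digit j (2 * v - (if v \<ge> 1/2 then 1 else 0))"

text \<open>The point of the Cantor set with ternary digits \<open>2 * e m\<close>. The gaps of this
  set are what allows \<open>ternary_digit\<close> to be continuous: it is constant on either side
  of a gap and linear across it.\<close>

definition cantor_point :: "(nat \<Rightarrow> real) \<Rightarrow> real" where
  "cantor_point e = (\<Sum>m. 2 * e m / 3 ^ Suc m)"

text \<open>All binary digits of all coordinates are interleaved through the pairing of
  \<open>nat \<times> nat\<close> with \<open>nat\<close>. The map is merely measurable, as binary
  digits jump; only \<open>decode\<close> has to be continuous.\<close>

definition encode :: "(nat \<Rightarrow> real) \<Rightarrow> real" where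
  "encode v = cantor_point (\<lambda>m. binary_digit (snd (prod_decode m)) (v (fst (prod_decode m))))"

text \<open>Defined and continuous on the whole line, also off the Cantor set, so that it can be
  composed with test functions for weak convergence of laws on the reals.\<close>

definition decode :: "nat \<Rightarrow> real \<Rightarrow> real" where
  "decode k s = (\<Sum>j. ternary_digit (prod_encode (k, j)) s / 2 ^ Suc j)"

lemma continuous_ternary_digit: "continuous_on UNIV (ternary_digit m)"
proof (induction m)
  case 0
  show ?case by (simp add: continuous_intros)
next
  case (Suc m)
  have "continuous_on UNIV (\<lambda>s::real. 3 * s - 2 * max 0 (min 1 (3 * s - 1)))"
    by (intro continuous_intros)
  from continuous_on_compose2[OF Suc this] show ?case by simp
qed

lemma ternary_digit_bounds: "0 \<le> ternary_digit m s \<and> ternary_digit m s \<le> 1"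
  by (induction m arbitrary: s) auto

lemma binary_digit_cases: "binary_digit j v = 0 \<or> binary_digit j v = 1"
  by (induction j arbitrary: v) auto

lemma measurable_binary_digit [measurable]: "binary_digit j \<in> borel_measurable borel"
proof (induction j)
  case 0
  have "(\<lambda>v::real. if v \<ge> 1/2 then 1 else 0 :: real) \<in> borel_measurable borel" by measurable
  moreover have "binary_digit 0 = (\<lambda>v::real. if v \<ge> 1/2 then 1 else 0)" by (auto intro!: ext)
  ultimately show ?case by simp
next
  case (Suc j)
  note [measurable] = Suc
  have "(\<lambda>v. binary_digit j (2 * v - (if v \<ge> 1/2 then 1 else 0))) \<in> borel_measurable borel"
    by measurable
  then show ?case by simp
qed

lemma summable_thirds:
  assumes "\<And>m. 0 \<le> e m \<and> e m \<le> (1::real)"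
  shows "summable (\<lambda>m. 2 * e m / 3 ^ Suc m)"
proof (rule summable_comparison_test')
  show "summable (\<lambda>m. 2 / 3 * (1 / 3 :: real) ^ m)" by (intro summable_mult summable_geometric) simp
  fix m show "norm (2 * e m / 3 ^ Suc m) \<le> 2 / 3 * (1 / 3) ^ m"
    using assms[of m] by (simp add: power_one_over field_simps)
qed

lemma cantor_point_shift:
  fixes e :: "nat \<Rightarrow> real"
  assumes "\<And>m. 0 \<le> e m \<and> e m \<le> (1::real)"
  shows "cantor_point e = (2 * e 0 + cantor_point (\<lambda>m. e (Suc m))) / 3"
proof -
  have s: "summable (\<lambda>m. 2 * e (Suc m) / 3 ^ Suc m)" using assms by (intro summable_thirds) auto
  have "cantor_point e = (\<Sum>m. 2 * e (Suc m) / 3 ^ Suc (Suc m)) + 2 * e 0 / 3"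
    unfolding cantor_point_def using suminf_split_initial_segment[where k = 1, OF summable_thirds[OF assms]] by simp
  also have "(\<Sum>m. 2 * e (Suc m) / 3 ^ Suc (Suc m)) = cantor_point (\<lambda>m. e (Suc m)) / 3"
    unfolding cantor_point_def using suminf_divide[OF s, of 3] by (simp add: field_simps)
  finally show ?thesis by (simp add: field_simps)
qed

lemma cantor_point_bounds:
  assumes "\<And>m. 0 \<le> e m \<and> e m \<le> (1::real)"
  shows "0 \<le> cantor_point e \<and> cantor_point e \<le> 1"
proof
  show "0 \<le> cantor_point e"
    unfolding cantor_point_def using assms by (intro suminf_nonneg summable_thirds) auto
  have g: "(\<lambda>m. 2 / 3 * (1 / 3 :: real) ^ m) sums (2 / 3 * (1 / (1 - 1 / 3)))"
    by (intro sums_mult geometric_sums) simp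
  have "cantor_point e \<le> (\<Sum>m. 2 / 3 * (1 / 3 :: real) ^ m)"
    unfolding cantor_point_def
  proof (rule suminf_le)
    show "2 * e m / 3 ^ Suc m \<le> 2 / 3 * (1 / 3) ^ m" for m
      using assms[of m] by (simp add: power_one_over field_simps)
  qed (use g summable_thirds[OF assms] in \<open>auto simp: sums_iff\<close>)
  also have "\<dots> = 1" using g by (simp add: sums_iff)
  finally show "cantor_point e \<le> 1" .
qed

text \<open>The tail contributes at most 1/3, so the point lies in \<open>[0, 1/3]\<close> or in
  \<open>[2/3, 1]\<close> according to \<open>e 0\<close>. There the clamped
  \<open>3 * s - 1\<close> is exactly 0 or 1, and removing this digit leaves the shifted
  point.\<close>

lemma ternary_digit_cantor_point:
  assumes "\<And>m. e m = 0 \<or> e m = (1::real)"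
  shows "ternary_digit m (cantor_point e) = e m"
  using assms
proof (induction m arbitrary: e)
  case (0 e)
  have b: "0 \<le> e m \<and> e m \<le> 1" for m using 0[of m] by auto
  have "0 \<le> cantor_point (\<lambda>m. e (Suc m)) \<and> cantor_point (\<lambda>m. e (Suc m)) \<le> 1"
    using b by (intro cantor_point_bounds) auto
  then show ?case using 0[of 0] unfolding cantor_point_shift[of e, OF b] by auto
next
  case (Suc m e)
  have b: "0 \<le> e m \<and> e m \<le> 1" for m using Suc.prems[of m] by auto
  have "0 \<le> cantor_point (\<lambda>m. e (Suc m)) \<and> cantor_point (\<lambda>m. e (Suc m)) \<le> 1"
    using b by (intro cantor_point_bounds) auto
  then have "3 * cantor_point e - 2 * max 0 (min 1 (3 * cantor_point e - 1)) = cantor_point (\<lambda>m. e (Suc m))"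
    using Suc.prems[of 0] unfolding cantor_point_shift[of e, OF b] by (auto simp: field_simps)
  then show ?case using Suc.IH[of "\<lambda>m. e (Suc m)"] Suc.prems by simp
qed

lemma summable_halves:
  assumes "\<And>m. 0 \<le> e m \<and> e m \<le> (1::real)"
  shows "summable (\<lambda>m. e m / 2 ^ Suc m)"
proof (rule summable_comparison_test')
  show "summable (\<lambda>m. 1 / 2 * (1 / 2 :: real) ^ m)" by (intro summable_mult summable_geometric) simp
  fix m show "norm (e m / 2 ^ Suc m) \<le> 1 / 2 * (1 / 2) ^ m"
    using assms[of m] by (simp add: power_one_over field_simps)
qed

text \<open>The remainder \<open>r\<close> is the \<open>n\<close>-th iterate of the doubling map,
  which keeps \<open>[0, 1]\<close> invariant. The endpoint 1 is a fixed point and gets the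
  expansion with all digits 1.\<close>

lemma binary_digit_partial_sum:
  assumes "0 \<le> v" "v \<le> 1"
  shows "\<exists>r. 0 \<le> r \<and> r \<le> 1 \<and> v = (\<Sum>j<n. binary_digit j v / 2 ^ Suc j) + r / 2 ^ n"
  using assms
proof (induction n arbitrary: v)
  case 0
  then show ?case by auto
next
  case (Suc n v)
  define d :: real where "d = (if v \<ge> 1/2 then 1 else 0)"
  have "0 \<le> 2 * v - d" "2 * v - d \<le> 1" using Suc.prems by (auto simp: d_def)
  from Suc.IH[OF this] obtain r where r: "0 \<le> r" "r \<le> 1"
    "2 * v - d = (\<Sum>j<n. binary_digit j (2 * v - d) / 2 ^ Suc j) + r / 2 ^ n" by blast
  have "(\<Sum>j<Suc n. binary_digit j v / 2 ^ Suc j)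
      = d / 2 + (\<Sum>j<n. binary_digit j (2 * v - d) / 2 ^ Suc j) / 2"
    by (subst sum.lessThan_Suc_shift) (auto simp: d_def sum_divide_distrib intro!: sum.cong)
  with r(3) have "v = (\<Sum>j<Suc n. binary_digit j v / 2 ^ Suc j) + r / 2 ^ Suc n"
    by (simp add: field_simps)
  with r show ?case by blast
qed

lemma binary_digit_sums:
  assumes "0 \<le> v" "v \<le> 1"
  shows "(\<lambda>j. binary_digit j v / 2 ^ Suc j) sums v"
proof -
  have lim: "(\<lambda>n. (1/2::real) ^ n) \<longlonglongrightarrow> 0" by (rule LIMSEQ_power_zero) simp
  have "norm (v - (\<Sum>j<n. binary_digit j v / 2 ^ Suc j)) \<le> (1/2) ^ n" for n
  proof -
    from binary_digit_partial_sum[OF assms, of n] obtain r where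
      "0 \<le> r" "r \<le> 1" "v = (\<Sum>j<n. binary_digit j v / 2 ^ Suc j) + r / 2 ^ n" by blast
    then have "v - (\<Sum>j<n. binary_digit j v / 2 ^ Suc j) = r / 2 ^ n" by linarith
    with \<open>0 \<le> r\<close> \<open>r \<le> 1\<close> show ?thesis by (simp add: power_one_over divide_right_mono)
  qed
  then have "(\<lambda>n. v - (\<Sum>j<n. binary_digit j v / 2 ^ Suc j)) \<longlonglongrightarrow> 0"
    by (intro Lim_null_comparison[OF _ lim]) simp
  from tendsto_diff[OF tendsto_const[of v] this] show ?thesis by (simp add: sums_def)
qed

lemma continuous_decode: "continuous_on UNIV (decode k)"
proof -
  have "uniform_limit UNIV (\<lambda>n s. \<Sum>j<n. ternary_digit (prod_encode (k, j)) s / 2 ^ Suc j)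
     (\<lambda>s. \<Sum>j. ternary_digit (prod_encode (k, j)) s / 2 ^ Suc j) sequentially"
  proof (rule Weierstrass_m_test)
    show "summable (\<lambda>m. 1 / 2 * (1 / 2 :: real) ^ m)" by (intro summable_mult summable_geometric) simp
    show "norm (ternary_digit (prod_encode (k, j)) s / 2 ^ Suc j) \<le> 1 / 2 * (1 / 2) ^ j" for j s
      using ternary_digit_bounds[of "prod_encode (k, j)" s] by (simp add: power_one_over field_simps)
  qed
  then show ?thesis unfolding decode_def[abs_def]
    by (rule uniform_limit_theorem[rotated])
       (auto intro!: always_eventually continuous_intros continuous_ternary_digit)
qed

lemma decode_bounds: "0 \<le> decode k s \<and> decode k s \<le> 1"
proof
  let ?t = "\<lambda>j. ternary_digit (prod_encode (k, j)) s"
  have b: "0 \<le> ?t j \<and> ?t j \<le> 1" for j by (rule ternary_digit_bounds)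
  show "0 \<le> decode k s"
    unfolding decode_def using b by (intro suminf_nonneg summable_halves) auto
  have g: "(\<lambda>m. 1 / 2 * (1 / 2 :: real) ^ m) sums (1 / 2 * (1 / (1 - 1 / 2)))"
    by (intro sums_mult geometric_sums) simp
  have "decode k s \<le> (\<Sum>m. 1 / 2 * (1 / 2 :: real) ^ m)"
    unfolding decode_def
  proof (rule suminf_le)
    show "?t m / 2 ^ Suc m \<le> 1 / 2 * (1 / 2) ^ m" for m
      using b[of m] by (simp add: power_one_over field_simps)
  qed (use g summable_halves[of ?t, OF b] in \<open>auto simp: sums_iff\<close>)
  also have "\<dots> = 1" using g by (simp add: sums_iff)
  finally show "decode k s \<le> 1" .
qed

lemma decode_encode:
  assumes "\<And>k. 0 \<le> v k \<and> v k \<le> 1"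
  shows "decode k (encode v) = v k"
proof -
  have "ternary_digit (prod_encode (k, j)) (encode v) = binary_digit j (v k)" for j
    unfolding encode_def by (subst ternary_digit_cantor_point) (auto simp: binary_digit_cases)
  then show ?thesis
    unfolding decode_def using binary_digit_sums[of "v k"] assms[of k] by (simp add: sums_iff)
qed

lemma encode_bounds: "0 \<le> encode v \<and> encode v \<le> 1"
  unfolding encode_def
proof (rule cantor_point_bounds)
  show "0 \<le> binary_digit j x \<and> binary_digit j x \<le> 1" for j x
    using binary_digit_cases[of j x] by auto
qed

lemma measurable_encode:
  assumes "\<And>k. V k \<in> borel_measurable P"
  shows "(\<lambda>\<omega>. encode (\<lambda>k. V k \<omega>)) \<in> borel_measurable P"
  unfolding encode_def cantor_point_def
  by (intro borel_measurable_suminf borel_measurable_divide borel_measurable_times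
      borel_measurable_const measurable_compose[OF assms measurable_binary_digit])

text \<open>Since \<^const>\<open>decode\<close> is a continuous left inverse of \<^const>\<open>encode\<close>, sequential compactness of
  the laws on \<open>[0,1]\<^sup>\<nat>\<close> reduces to Helly's theorem on the real line.\<close>

lemma random_sequences_convergent_subsequence:
  fixes P :: "nat \<Rightarrow> 'b measure" and V :: "nat \<Rightarrow> nat \<Rightarrow> 'b \<Rightarrow> real"
  assumes P: "\<And>n. prob_space (P n)"
    and V: "\<And>n k. V n k \<in> borel_measurable (P n)"
    and V01: "\<And>n k \<omega>. 0 \<le> V n k \<omega> \<and> V n k \<omega> \<le> 1"
  obtains r :: "nat \<Rightarrow> nat" and L :: "real measure"
  where "strict_mono r" "real_distribution L"
    "\<And>(f :: (nat \<Rightarrow> real) \<Rightarrow> real) C. continuous_on UNIV (\<lambda>s. f (\<lambda>k. decode k s)) \<Longrightarrow> (\<And>s. \<bar>f (\<lambda>k. decode k s)\<bar> \<le> C) \<Longrightarrow>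
       (\<lambda>n. \<integral>\<omega>. f (\<lambda>k. V (r n) k \<omega>) \<partial>P (r n)) \<longlonglongrightarrow> (\<integral>s. f (\<lambda>k. decode k s) \<partial>L)"
proof -
  define L where "L n = distr (P n) borel (\<lambda>\<omega>. encode (\<lambda>k. V n k \<omega>))" for n
  have enc: "(\<lambda>\<omega>. encode (\<lambda>k. V n k \<omega>)) \<in> borel_measurable (P n)" for n
    by (intro measurable_encode V)
  have L: "real_distribution (L n)" for n
    unfolding L_def using prob_space.real_distribution_distr[OF P] enc by blast
  have "tight L"
    unfolding tight_def
  proof (intro conjI allI impI L)
    fix \<epsilon> :: real assume "0 < \<epsilon>"
    \<comment> \<open>Tightness is phrased with left-open intervals, and the code 0 occurs; hence
      the left end -1.\<close>
    have "measure (L n) {-1<..1} = 1" for n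
    proof -
      have "(\<lambda>\<omega>. encode (\<lambda>k. V n k \<omega>)) -` {-1<..1} \<inter> space (P n) = space (P n)"
      proof -
        have "-1 < encode v" for v using encode_bounds[of v] by linarith
        then show ?thesis using encode_bounds by auto
      qed
      then show ?thesis
        unfolding L_def using prob_space.prob_space[OF P] by (subst measure_distr[OF enc]) auto
    qed
    then show "\<exists>a b. a < b \<and> (\<forall>n. 1 - \<epsilon> < measure (L n) {a<..b})"
      using \<open>0 < \<epsilon>\<close> by (intro exI[of _ "-1"] exI[of _ 1]) auto
  qed
  from tight_imp_convergent_subsubsequence[OF this, of id] obtain r l where
    r: "strict_mono (r :: nat \<Rightarrow> nat)" "real_distribution l" "weak_conv_m (L \<circ> id \<circ> r) l"
    by (auto simp: strict_mono_def)
  show ?thesis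
  proof (rule that[OF r(1,2)])
    fix f :: "(nat \<Rightarrow> real) \<Rightarrow> real" and C assume c: "continuous_on UNIV (\<lambda>s. f (\<lambda>k. decode k s))"
      and b: "\<And>s. \<bar>f (\<lambda>k. decode k s)\<bar> \<le> C"
    have "(\<lambda>n. \<integral>s. f (\<lambda>k. decode k s) \<partial>L (r n)) \<longlonglongrightarrow> (\<integral>s. f (\<lambda>k. decode k s) \<partial>l)"
    proof (rule weak_conv_imp_integral_bdd_continuous_conv)
      show "weak_conv_m (\<lambda>n. L (r n)) l" using r(3) by (simp add: comp_def)
    qed (use L r(2) b c in \<open>auto simp: continuous_on_eq_continuous_at\<close>)
    \<comment> \<open>The discontinuous coding enters only through the law \<open>L n\<close>;
      inside the integral it cancels against \<open>decode\<close>, as all coordinates lie in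
      \<open>[0, 1]\<close>.\<close>
    moreover have "(\<integral>s. f (\<lambda>k. decode k s) \<partial>L n) = (\<integral>\<omega>. f (\<lambda>k. V n k \<omega>) \<partial>P n)" for n
      unfolding L_def by (subst integral_distr[OF enc borel_measurable_continuous_onI[OF c]])
        (simp add: decode_encode V01)
    ultimately show "(\<lambda>n. \<integral>\<omega>. f (\<lambda>k. V (r n) k \<omega>) \<partial>P (r n)) \<longlonglongrightarrow> (\<integral>s. f (\<lambda>k. decode k s) \<partial>l)"
      by simp
  qed
qed

section \<open>The kernel of the Levy-Khintchine exponent\<close>

text \<open>Isabelle sets \<open>0 powr 0 = 0\<close>, whereas \<open>e\<^sup>-\<^sup>0\<^sup>\<infinity> = 1\<close>.\<close>

definition rpow :: "real \<Rightarrow> real \<Rightarrow> real" where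
  "rpow z u = (if z = 0 then 1 else u powr z)"

text \<open>The value at \<open>s = 0\<close> is the limit of the quotient, namely the derivative of
  \<open>1 - (1 - s) powr z\<close> at 0.\<close>

definition rpow_quot :: "real \<Rightarrow> real \<Rightarrow> real" where
  "rpow_quot z s = (if s = 0 then z else (1 - rpow z (1 - s)) / s)"

text \<open>Weak convergence needs a kernel that is continuous for all arguments, while
  \<open>w * y k \<le> 1\<close> holds in the limit only almost surely. Clipping extends the kernel
  to the other points.\<close>

definition clip :: "real \<Rightarrow> real" where
  "clip s = max 0 (min 1 s)"

text \<open>This is \<open>(1 - (\<Prod>i<d. (1 - w * y i) powr z i)) / w\<close>, telescoped so that the singularity
  at \<open>w = 0\<close> is removed.\<close>

definition levy_kernel :: "nat \<Rightarrow> (nat \<Rightarrow> real) \<Rightarrow> real \<Rightarrow> (nat \<Rightarrow> real) \<Rightarrow> real" where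
  "levy_kernel d z w y =
     (\<Sum>i<d. (\<Prod>j<i. rpow (z j) (1 - clip (w * y j))) * (y i * rpow_quot (z i) (clip (w * y i))))"

lemma clip_bounds: "0 \<le> clip s" "clip s \<le> 1"
  by (auto simp: clip_def)

lemma clip_id: "0 \<le> s \<Longrightarrow> s \<le> 1 \<Longrightarrow> clip s = s"
  by (auto simp: clip_def)

lemma continuous_clip: "continuous_on UNIV clip"
  unfolding clip_def[abs_def] by (intro continuous_intros)

lemma rpow_bounds:
  assumes "0 \<le> z" "0 \<le> u" "u \<le> 1"
  shows "0 \<le> rpow z u" "rpow z u \<le> 1"
  using assms powr_mono2[of z u 1] by (auto simp: rpow_def)

lemma rpow_1 [simp]: "rpow z 1 = 1"
  by (simp add: rpow_def)

lemma measurable_rpow [measurable]: "rpow z \<in> borel_measurable borel"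
  unfolding rpow_def[abs_def] by measurable

lemma continuous_rpow:
  assumes "0 \<le> z"
  shows "continuous_on {0..1} (rpow z)"
proof (cases "z = 0")
  case False
  then have "continuous_on {0..1} (\<lambda>u. u powr z)"
    using assms by (intro continuous_on_powr' continuous_intros) auto
  then show ?thesis using False by (simp add: rpow_def[abs_def])
qed (simp add: rpow_def[abs_def])

text \<open>Only the origin needs an argument; there the quotient is the difference quotient of
  \<open>- ((1 - s) powr z)\<close>, whose derivative at 0 is \<open>z\<close>.\<close>

lemma continuous_rpow_quot:
  assumes "0 \<le> z"
  shows "continuous_on {0..1} (rpow_quot z)"
  unfolding continuous_on
proof
  fix x :: real assume x: "x \<in> {0..1}"
  show "(rpow_quot z \<longlongrightarrow> rpow_quot z x) (at x within {0..1})"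
  proof (cases "x = 0")
    case True
    have "((\<lambda>h. (1 - rpow z (1 - h)) / h) \<longlongrightarrow> z) (at 0)"
    proof (cases "z = 0")
      case False
      have "((\<lambda>s::real. - ((1 - s) powr z)) has_real_derivative z) (at 0)"
        by (auto intro!: derivative_eq_intros)
      then show ?thesis using False by (simp add: DERIV_def rpow_def)
    qed (simp add: rpow_def)
    then have "(rpow_quot z \<longlongrightarrow> z) (at 0)"
      by (rule Lim_transform_eventually) (auto simp: rpow_quot_def eventually_at_filter)
    then show ?thesis using True
      by (auto simp: rpow_quot_def intro: tendsto_within_subset)
  next
    case False
    have "continuous_on {0..1} (\<lambda>s. rpow z (1 - s))"
      by (rule continuous_on_compose2[OF continuous_rpow[OF assms]]) (auto intro!: continuous_intros)
    then have "((\<lambda>s. rpow z (1 - s)) \<longlongrightarrow> rpow z (1 - x)) (at x within {0..1})"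
      using x by (auto simp: continuous_on)
    then have "((\<lambda>s. (1 - rpow z (1 - s)) / s) \<longlongrightarrow> (1 - rpow z (1 - x)) / x) (at x within {0..1})"
      using False by (intro tendsto_intros) auto
    then have "(rpow_quot z \<longlongrightarrow> (1 - rpow z (1 - x)) / x) (at x within {0..1})"
    proof (rule Lim_transform_eventually)
      show "\<forall>\<^sub>F s in at x within {0..1}. (1 - rpow z (1 - s)) / s = rpow_quot z s"
        using eventually_neq_at_within[of 0 x "{0..1}"]
        by eventually_elim (simp add: rpow_quot_def)
    qed
    then show ?thesis using False by (simp add: rpow_quot_def)
  qed
qed

lemma continuous_levy_kernel:
  assumes w: "(w \<longlongrightarrow> w0) F" and y: "\<And>i. i < d \<Longrightarrow> ((\<lambda>r. y r i) \<longlongrightarrow> y0 i) F"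
    and z: "\<And>i. i < d \<Longrightarrow> 0 \<le> z i"
  shows "((\<lambda>r. levy_kernel d z (w r) (y r)) \<longlongrightarrow> levy_kernel d z w0 y0) F"
proof -
  have c: "((\<lambda>r. clip (w r * y r i)) \<longlongrightarrow> clip (w0 * y0 i)) F" if "i < d" for i
    by (rule continuous_on_tendsto_compose[OF continuous_clip])
      (auto intro!: tendsto_mult w y that)
  have 1: "((\<lambda>r. rpow (z i) (1 - clip (w r * y r i))) \<longlongrightarrow> rpow (z i) (1 - clip (w0 * y0 i))) F" if "i < d" for i
    by (rule continuous_on_tendsto_compose[OF continuous_rpow[OF z[OF that]]])
      (auto intro!: tendsto_intros c that simp: clip_bounds)
  have 2: "((\<lambda>r. rpow_quot (z i) (clip (w r * y r i))) \<longlongrightarrow> rpow_quot (z i) (clip (w0 * y0 i))) F" if "i < d" for i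
    by (rule continuous_on_tendsto_compose[OF continuous_rpow_quot[OF z[OF that]]])
      (auto intro!: tendsto_intros c that simp: clip_bounds)
  show ?thesis
    unfolding levy_kernel_def by (intro tendsto_sum tendsto_mult tendsto_prod 1 2 y) auto
qed

text \<open>The bound is uniform in \<open>w\<close>, because \<open>w\<close> enters only through
  clipped arguments in \<open>[0, 1]\<close>, a compact set on which \<open>rpow_quot\<close> is
  continuous.\<close>

lemma levy_kernel_bounded:
  assumes z: "\<And>i. i < d \<Longrightarrow> 0 \<le> z i"
  shows "\<exists>C. \<forall>w y. (\<forall>i<d. \<bar>y i\<bar> \<le> B i) \<longrightarrow> \<bar>levy_kernel d z w y\<bar> \<le> C"
proof -
  have "\<exists>C. \<forall>s\<in>{0..1}. \<bar>rpow_quot (z i) s\<bar> \<le> C" if "i < d" for i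
  proof -
    have "compact (rpow_quot (z i) ` {0..1})"
      using continuous_rpow_quot[OF z[OF that]] by (intro compact_continuous_image) auto
    then obtain C where "\<forall>x\<in>rpow_quot (z i) ` {0..1}. norm x \<le> C"
      using compact_imp_bounded bounded_iff by blast
    then show ?thesis by (intro exI[of _ C]) auto
  qed
  then obtain C where C: "\<And>i s. i < d \<Longrightarrow> 0 \<le> s \<Longrightarrow> s \<le> 1 \<Longrightarrow> \<bar>rpow_quot (z i) s\<bar> \<le> C i"
    by (metis atLeastAtMost_iff)
  show ?thesis
  proof (intro exI[of _ "\<Sum>i<d. B i * C i"] allI impI)
    fix w y assume y: "\<forall>i<d. \<bar>y i\<bar> \<le> B i"
    have "\<bar>levy_kernel d z w y\<bar> \<le>
      (\<Sum>i<d. \<bar>(\<Prod>j<i. rpow (z j) (1 - clip (w * y j))) * (y i * rpow_quot (z i) (clip (w * y i)))\<bar>)"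
      unfolding levy_kernel_def by (rule sum_abs)
    also have "\<dots> \<le> (\<Sum>i<d. 1 * (B i * C i))"
    proof (rule sum_mono)
      fix i assume i: "i \<in> {..<d}"
      have r: "0 \<le> rpow (z j) (1 - clip (w * y j)) \<and> rpow (z j) (1 - clip (w * y j)) \<le> 1" if "j < i" for j
        using rpow_bounds[of "z j"] z[of j] i that clip_bounds[of "w * y j"] by auto
      have "\<bar>\<Prod>j<i. rpow (z j) (1 - clip (w * y j))\<bar> \<le> 1"
        using r by (simp add: abs_prod) (intro prod_le_1, auto)
      moreover have "\<bar>y i\<bar> \<le> B i" "\<bar>rpow_quot (z i) (clip (w * y i))\<bar> \<le> C i"
        using y i C clip_bounds by auto
      ultimately show "\<bar>(\<Prod>j<i. rpow (z j) (1 - clip (w * y j))) * (y i * rpow_quot (z i) (clip (w * y i)))\<bar>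
          \<le> 1 * (B i * C i)"
        unfolding abs_mult by (intro mult_mono) auto
    qed
    finally show "\<bar>levy_kernel d z w y\<bar> \<le> (\<Sum>i<d. B i * C i)" by simp
  qed
qed

text \<open>Telescoping: one minus a product of factors \<open>c i\<close> is the sum over
  \<open>i\<close> of \<open>(\<Prod>j<i. c j) * (1 - c i)\<close>. Multiplication by
  \<open>w\<close> turns each quotient back into \<open>1 - c i\<close>, also when
  \<open>w * y i = 0\<close>.\<close>

lemma levy_kernel_mult:
  assumes "\<And>i. i < d \<Longrightarrow> 0 \<le> w * y i \<and> w * y i \<le> 1"
  shows "w * levy_kernel d z w y = 1 - (\<Prod>i<d. rpow (z i) (1 - w * y i))"
  using assms
proof (induction d)
  case 0
  then show ?case by (simp add: levy_kernel_def)
next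
  case (Suc d)
  have "w * levy_kernel (Suc d) z w y = w * levy_kernel d z w y
      + (\<Prod>j<d. rpow (z j) (1 - w * y j)) * (w * y d * rpow_quot (z d) (w * y d))"
    using Suc.prems by (simp add: levy_kernel_def clip_id ring_distribs)
  also have "w * y d * rpow_quot (z d) (w * y d) = 1 - rpow (z d) (1 - w * y d)"
    by (auto simp: rpow_quot_def)
  finally show ?case using Suc by (simp add: algebra_simps)
qed

text \<open>The source of the linear drift term in the exponent.\<close>

lemma levy_kernel_0_left: "levy_kernel d z 0 y = (\<Sum>i<d. z i * y i)"
  by (simp add: levy_kernel_def clip_def rpow_quot_def mult.commute)

text \<open>Makes the kernel blind to an atom at the zero sequence, which is added later to complete
  finite measures to probabilities.\<close>

lemma levy_kernel_0_right: "levy_kernel d z w (\<lambda>_. 0) = 0"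
  by (simp add: levy_kernel_def)

text \<open>Independence of \<open>w\<close> is the point: the mean of a slope becomes a value of
  the Laplace exponent.\<close>

lemma levy_kernel_single: "levy_kernel 1 (\<lambda>_. 1) w y = y 0"
  by (auto simp: levy_kernel_def rpow_quot_def rpow_def clip_def)

lemma measurable_clip [measurable]: "clip \<in> borel_measurable borel"
  unfolding clip_def[abs_def] by measurable

lemma measurable_levy_kernel [measurable]:
  assumes [measurable]: "w \<in> borel_measurable M" "\<And>i. (\<lambda>r. y r i) \<in> borel_measurable M"
  shows "(\<lambda>r. levy_kernel d z (w r) (y r)) \<in> borel_measurable M"
  unfolding levy_kernel_def rpow_quot_def by measurable

section \<open>Laplace exponentials of extended non-negative numbers\<close>

lemma exp_minus_0 [simp]: "exp_minus 0 = 1"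
  by (simp add: exp_minus_def)

lemma exp_minus_infty [simp]: "exp_minus \<infinity> = 0"
  by (simp add: exp_minus_def)

lemma exp_minus_ereal [simp]: "exp_minus (ereal x) = exp (- x)"
  by (simp add: exp_minus_def)

lemma exp_minus_bounds:
  assumes "0 \<le> x"
  shows "0 \<le> exp_minus x" "exp_minus x \<le> 1"
  using assms by (cases x; simp)+

lemma exp_minus_eq_0_iff: "0 \<le> x \<Longrightarrow> exp_minus x = 0 \<longleftrightarrow> x = \<infinity>"
  by (cases x) auto

lemma exp_minus_antimono: "0 \<le> x \<Longrightarrow> x \<le> y \<Longrightarrow> exp_minus y \<le> exp_minus x"
  by (cases x; cases y) auto

lemma measurable_exp_minus [measurable]: "exp_minus \<in> borel_measurable borel"
  unfolding exp_minus_def[abs_def] by measurable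

lemma exp_minus_add: "0 \<le> x \<Longrightarrow> 0 \<le> y \<Longrightarrow> exp_minus (x + y) = exp_minus x * exp_minus y"
  by (cases x; cases y) (auto simp: exp_add[symmetric])

lemma exp_minus_sum:
  assumes "\<And>i. i \<in> A \<Longrightarrow> 0 \<le> x i"
  shows "exp_minus (\<Sum>i\<in>A. x i) = (\<Prod>i\<in>A. exp_minus (x i))"
  using assms by (induction A rule: infinite_finite_induct) (auto simp: exp_minus_add sum_nonneg)

text \<open>The delicate case is \<open>z = 0\<close> and \<open>x = \<infinity>\<close>, where
  \<open>0 * \<infinity> = 0\<close> on the left meets \<open>rpow 0 0 = 1\<close> on the
  right.\<close>

lemma exp_minus_times: "0 \<le> z \<Longrightarrow> 0 \<le> x \<Longrightarrow> exp_minus (ereal z * x) = rpow z (exp_minus x)"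
  by (cases x) (auto simp: rpow_def powr_def zero_ereal_def[symmetric])

lemma exp_minus_weighted_sum:
  assumes "\<And>i. i < d \<Longrightarrow> 0 \<le> z i" "\<And>i. i < d \<Longrightarrow> 0 \<le> x i"
  shows "exp_minus (\<Sum>i<d. ereal (z i) * x i) = (\<Prod>i<d. rpow (z i) (exp_minus (x i)))"
  using assms by (subst exp_minus_sum) (auto simp: exp_minus_times intro!: prod.cong)

lemma exp_minus_tendsto:
  assumes "(f \<longlongrightarrow> l) F" "\<forall>\<^sub>F x in F. 0 \<le> f x" "0 \<le> l"
  shows "((\<lambda>x. exp_minus (f x)) \<longlongrightarrow> exp_minus l) F"
proof (cases l)
  case (real r)
  have "((\<lambda>x. exp (- real_of_ereal (f x))) \<longlongrightarrow> exp (- r)) F"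
    using assms(1) unfolding real by (intro tendsto_intros) (auto intro: lim_real_of_ereal)
  moreover have "\<forall>\<^sub>F x in F. f x < \<infinity>"
    using assms(1) real by (intro order_tendstoD(2)[OF assms(1)]) auto
  ultimately show ?thesis unfolding real
    by (auto intro: Lim_transform_eventually elim!: eventually_mono simp: exp_minus_def)
next
  case PInf
  show ?thesis
  proof (rule order_tendstoI)
    fix a assume "a < exp_minus l"
    then show "\<forall>\<^sub>F x in F. a < exp_minus (f x)"
      using assms(2) PInf by (auto elim!: eventually_mono dest!: exp_minus_bounds(1))
  next
    fix a assume "exp_minus l < a"
    then have a: "0 < a" using PInf by simp
    have "\<forall>\<^sub>F x in F. ereal (- ln a) < f x"
      using assms(1) PInf by (intro order_tendstoD(1)[OF assms(1)]) auto
    then show "\<forall>\<^sub>F x in F. exp_minus (f x) < a"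
    proof eventually_elim
      case (elim x)
      show ?case
      proof (cases "f x")
        case (real r)
        with elim have "- r < ln a" by simp
        then have "exp (- r) < exp (ln a)" by (simp only: exp_less_cancel_iff)
        then show ?thesis using real a by simp
      qed (use elim a in auto)
    qed
  qed
qed (use assms in auto)

text \<open>Inverts \<open>1 - exp_minus\<close>, leading from the coordinates in
  \<open>[0, 1]\<close> back to path values; the coordinate 1 corresponds to the value
  infinity.\<close>

definition log_ext :: "real \<Rightarrow> ereal" where
  "log_ext s = (if s < 1 then ereal (- ln (1 - s)) else \<infinity>)"

lemma exp_minus_log_ext: "s \<le> 1 \<Longrightarrow> exp_minus (log_ext s) = 1 - s"
  by (auto simp: log_ext_def)

lemma log_ext_0 [simp]: "log_ext 0 = 0"
  by (simp add: log_ext_def)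

lemma log_ext_mono: "s \<le> t \<Longrightarrow> log_ext s \<le> log_ext t"
  by (auto simp: log_ext_def)

lemma log_ext_nonneg: "0 \<le> s \<Longrightarrow> 0 \<le> log_ext s"
  using log_ext_mono[of 0 s] by simp

lemma measurable_log_ext [measurable]: "log_ext \<in> borel_measurable borel"
  unfolding log_ext_def[abs_def] by measurable

lemma log_ext_tendsto:
  assumes f: "(f \<longlongrightarrow> l) F"
  shows "((\<lambda>x. log_ext (f x)) \<longlongrightarrow> log_ext l) F"
proof (cases "l < 1")
  case True
  have "((\<lambda>x. ereal (- ln (1 - f x))) \<longlongrightarrow> ereal (- ln (1 - l))) F"
    using True by (intro tendsto_intros f) auto
  then have "((\<lambda>x. log_ext (f x)) \<longlongrightarrow> ereal (- ln (1 - l))) F"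
    by (rule Lim_transform_eventually)
      (use order_tendstoD(2)[OF f True] in \<open>auto elim!: eventually_mono simp: log_ext_def\<close>)
  then show ?thesis using True by (simp add: log_ext_def)
next
  case False
  have "((\<lambda>x. log_ext (f x)) \<longlongrightarrow> \<infinity>) F"
    unfolding tendsto_PInfty
  proof
    fix c :: real
    have "1 - exp (- c) < l" using False by (auto intro: less_le_trans[of _ 1])
    from order_tendstoD(1)[OF f this] show "\<forall>\<^sub>F x in F. ereal c < log_ext (f x)"
    proof eventually_elim
      case (elim x)
      have "c < - ln (1 - f x)" if "f x < 1"
      proof -
        have "ln (1 - f x) < ln (exp (- c))" using elim that by (subst ln_less_cancel_iff) auto
        then show ?thesis by simp
      qed
      then show ?case by (auto simp: log_ext_def)
    qed
  qed
  then show ?thesis using False by (simp add: log_ext_def)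
qed

text \<open>The atom absorbs the missing mass; it sits at a point where the functions of interest vanish.\<close>

lemma prob_space_density_with_atom:
  fixes g :: "'a \<Rightarrow> real"
  assumes "prob_space N" and g: "integrable N g" "\<And>\<omega>. 0 \<le> g \<omega>" "integral\<^sup>L N g \<le> 1"
  defines "P \<equiv> density (N \<Otimes>\<^sub>M count_space (UNIV :: bool set))
    (\<lambda>(\<omega>, b). ennreal (if b then g \<omega> else 1 - integral\<^sup>L N g))"
  shows "prob_space P"
    and "\<And>h :: 'a \<times> bool \<Rightarrow> real. h \<in> borel_measurable P \<Longrightarrow> (\<And>\<omega>. h (\<omega>, False) = 0) \<Longrightarrow>
      integral\<^sup>L P h = (\<integral>\<omega>. g \<omega> * h (\<omega>, True) \<partial>N)"
proof -
  interpret N: prob_space N by fact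
  interpret B: sigma_finite_measure "count_space (UNIV :: bool set)"
    by (rule sigma_finite_measure_count_space_finite) simp
  interpret NB: pair_sigma_finite N "count_space (UNIV :: bool set)" ..
  let ?m = "integral\<^sup>L N g"
  let ?f = "\<lambda>(\<omega>, b). (if b then g \<omega> else 1 - ?m)"
  have [measurable]: "g \<in> borel_measurable N" using g by auto
  have f [measurable]: "?f \<in> borel_measurable (N \<Otimes>\<^sub>M count_space UNIV)"
    by measurable
  have nn: "(\<integral>\<^sup>+x. F x \<partial>(N \<Otimes>\<^sub>M count_space (UNIV :: bool set))) = (\<integral>\<^sup>+\<omega>. F (\<omega>, True) + F (\<omega>, False) \<partial>N)"
    if "F \<in> borel_measurable (N \<Otimes>\<^sub>M count_space UNIV)" for F
    using that by (subst B.nn_integral_fst[symmetric])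
      (auto simp: nn_integral_count_space_finite UNIV_bool add.commute intro!: nn_integral_cong)
  have P: "P = density (N \<Otimes>\<^sub>M count_space UNIV) (\<lambda>x. ennreal (?f x))"
    unfolding P_def by (intro arg_cong2[where f = density] refl ext) (auto split: prod.split)
  show "prob_space P"
  proof
    have "emeasure P (space P) = (\<integral>\<^sup>+x. ennreal (?f x) \<partial>(N \<Otimes>\<^sub>M count_space UNIV))"
      unfolding P by (subst emeasure_density) (auto intro!: nn_integral_cong)
    also have "\<dots> = (\<integral>\<^sup>+\<omega>. ennreal (g \<omega>) + ennreal (1 - ?m) \<partial>N)"
      by (subst nn) auto
    also have "\<dots> = ennreal ?m + ennreal (1 - ?m)"
      using g by (subst nn_integral_add) (auto simp: nn_integral_eq_integral N.emeasure_space_1)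
    also have "\<dots> = 1"
      using g by (subst ennreal_plus[symmetric]) (auto intro!: integral_nonneg_AE)
    finally show "emeasure P (space P) = 1" .
  qed
  fix h :: "'a \<times> bool \<Rightarrow> real" assume h: "h \<in> borel_measurable P" "\<And>\<omega>. h (\<omega>, False) = 0"
  have [measurable]: "h \<in> borel_measurable (N \<Otimes>\<^sub>M count_space UNIV)"
    using h(1) by (simp add: P)
  have "integral\<^sup>L P h = (\<integral>x. ?f x * h x \<partial>(N \<Otimes>\<^sub>M count_space UNIV))"
    unfolding P using g(2,3) by (subst integral_density) auto
  also have "\<dots> = (\<integral>\<omega>. g \<omega> * h (\<omega>, True) \<partial>N)"
  \<comment> \<open>Integrability of \<open>h\<close> is not among the hypotheses. The two
    integrands are integrable together, and otherwise both integrals have the default value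
    0.\<close>
  proof (cases "integrable N (\<lambda>\<omega>. g \<omega> * h (\<omega>, True))")
    case True
    have "integrable (N \<Otimes>\<^sub>M count_space UNIV) (\<lambda>x. ?f x * h x)"
      using True h(2) by (auto simp: integrable_iff_bounded nn)
    from NB.integral_fst'[OF this] show ?thesis
      using h(2) by (simp add: UNIV_bool lebesgue_integral_count_space_finite)
  next
    case False
    moreover have "\<not> integrable (N \<Otimes>\<^sub>M count_space UNIV) (\<lambda>x. ?f x * h x)"
      using False h(2) by (auto simp: integrable_iff_bounded nn)
    ultimately show ?thesis by (simp add: not_integrable_integral_eq)
  qed
  finally show "integral\<^sup>L P h = (\<integral>\<omega>. g \<omega> * h (\<omega>, True) \<partial>N)" .
qed

section \<open>Convolution roots\<close>

lemma stoch_process_measurable_restrict: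
  assumes "stoch_process M X"
  shows "(\<lambda>\<omega>. \<lambda>t\<in>J. X t \<omega>) \<in> measurable M (Pi\<^sub>M J (\<lambda>_. borel))"
  using assms by (intro measurable_restrict) (auto simp: stoch_process_def)

lemma same_fdd_integral:
  fixes F :: "(real \<Rightarrow> ereal) \<Rightarrow> real"
  assumes "same_fdd M X N Y" "stoch_process M X" "stoch_process N Y" "finite J"
    and F: "F \<in> borel_measurable (Pi\<^sub>M J (\<lambda>_. borel))"
  shows "(\<integral>\<omega>. F (\<lambda>t\<in>J. X t \<omega>) \<partial>M) = (\<integral>\<omega>. F (\<lambda>t\<in>J. Y t \<omega>) \<partial>N)"
proof -
  have "(\<integral>\<omega>. F (\<lambda>t\<in>J. X t \<omega>) \<partial>M) = (\<integral>f. F f \<partial>distr M (Pi\<^sub>M J (\<lambda>_. borel)) (\<lambda>\<omega>. \<lambda>t\<in>J. X t \<omega>))"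
    by (rule integral_distr[OF stoch_process_measurable_restrict F, symmetric]) fact
  also have "\<dots> = (\<integral>f. F f \<partial>distr N (Pi\<^sub>M J (\<lambda>_. borel)) (\<lambda>\<omega>. \<lambda>t\<in>J. Y t \<omega>))"
    using assms by (simp add: same_fdd_def)
  also have "\<dots> = (\<integral>\<omega>. F (\<lambda>t\<in>J. Y t \<omega>) \<partial>N)"
    by (rule integral_distr[OF stoch_process_measurable_restrict F]) fact
  finally show ?thesis .
qed

lemma same_fdd_AE:
  assumes "same_fdd M X N Y" "stoch_process M X" "stoch_process N Y" "finite J"
    and B: "B \<in> sets (Pi\<^sub>M J (\<lambda>_. borel))"
  shows "(AE \<omega> in M. (\<lambda>t\<in>J. X t \<omega>) \<in> B) \<longleftrightarrow> (AE \<omega> in N. (\<lambda>t\<in>J. Y t \<omega>) \<in> B)"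
proof -
  have B': "{x \<in> space (Pi\<^sub>M J (\<lambda>_. borel)). x \<in> B} \<in> sets (Pi\<^sub>M J (\<lambda>_. borel))"
    using B sets.sets_into_space[OF B] by (simp add: Collect_conj_eq Int_absorb1)
  have "(AE \<omega> in M. (\<lambda>t\<in>J. X t \<omega>) \<in> B) \<longleftrightarrow>
      (AE f in distr M (Pi\<^sub>M J (\<lambda>_. borel)) (\<lambda>\<omega>. \<lambda>t\<in>J. X t \<omega>). f \<in> B)"
    by (rule AE_distr_iff[OF stoch_process_measurable_restrict B', symmetric]) fact
  also have "\<dots> \<longleftrightarrow> (AE f in distr N (Pi\<^sub>M J (\<lambda>_. borel)) (\<lambda>\<omega>. \<lambda>t\<in>J. Y t \<omega>). f \<in> B)"
  proof -
    have "distr M (Pi\<^sub>M J (\<lambda>_. borel)) (\<lambda>\<omega>. \<lambda>t\<in>J. X t \<omega>) = distr N (Pi\<^sub>M J (\<lambda>_. borel)) (\<lambda>\<omega>. \<lambda>t\<in>J. Y t \<omega>)"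
      using assms by (simp add: same_fdd_def)
    then show ?thesis by (simp only:)
  qed
  also have "\<dots> \<longleftrightarrow> (AE \<omega> in N. (\<lambda>t\<in>J. Y t \<omega>) \<in> B)"
    by (rule AE_distr_iff[OF stoch_process_measurable_restrict B']) fact
  finally show ?thesis .
qed

text \<open>By independence and equality in law, the probability that all \<open>n\<close> copies
  hit \<open>B\<close> is the \<open>n\<close>-th power of the probability for one copy. If the
  former is 0, so is the latter.\<close>

lemma iid_processes_not_simultaneous:
  assumes iid: "iid_processes N n X" and "finite J" and "n > 0"
    and B: "B \<in> sets (Pi\<^sub>M J (\<lambda>_. borel))"
    and AE: "AE \<omega> in N. \<not> (\<forall>i<n. (\<lambda>t\<in>J. X i t \<omega>) \<in> B)"
  shows "AE \<omega> in N. (\<lambda>t\<in>J. X 0 t \<omega>) \<notin> B"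
proof -
  have sp: "stoch_process N (X i)" if "i < n" for i using iid that by (simp add: iid_processes_def)
  interpret N: prob_space N using sp[OF \<open>n > 0\<close>] by (simp add: stoch_process_def)
  define E where "E i = {\<omega> \<in> space N. (\<lambda>t\<in>J. X i t \<omega>) \<in> B}" for i
  have E: "E i \<in> sets N" if "i < n" for i
    using measurable_sets[OF stoch_process_measurable_restrict[OF sp[OF that]] B]
    unfolding E_def vimage_def Int_def by (simp add: conj_commute)
  have eq: "N.prob (E i) = N.prob (E 0)" if "i < n" for i
  proof -
    have *: "measure (distr N (Pi\<^sub>M J (\<lambda>_. borel)) (\<lambda>\<omega>. \<lambda>t\<in>J. X j t \<omega>)) B = N.prob (E j)" if "j < n" for j
      by (subst measure_distr[OF stoch_process_measurable_restrict[OF sp[OF that]] B])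
        (auto simp: E_def intro!: arg_cong[where f = N.prob])
    have "same_fdd N (X i) N (X 0)" using iid that \<open>n > 0\<close> by (simp add: iid_processes_def)
    then show ?thesis using *[OF that] *[OF \<open>n > 0\<close>] \<open>finite J\<close> by (simp add: same_fdd_def)
  qed
  \<comment> \<open>Independence is stated for entire paths, so the event on the times
    \<open>J\<close> is lifted to the full product.\<close>
  define B' where "B' = (\<lambda>f. restrict f J) -` B \<inter> space (Pi\<^sub>M UNIV (\<lambda>_. borel :: ereal measure))"
  have B': "B' \<in> sets (Pi\<^sub>M UNIV (\<lambda>_. borel))"
    unfolding B'_def by (rule measurable_sets[OF measurable_restrict_subset B]) simp
  have EB: "E i = (\<lambda>\<omega> t. X i t \<omega>) -` B' \<inter> space N" for i
    by (auto simp: E_def B'_def space_PiM)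
  have indep: "N.indep_vars (\<lambda>_. Pi\<^sub>M UNIV (\<lambda>_. borel)) (\<lambda>i \<omega> t. X i t \<omega>) {..<n}"
    using iid by (simp add: iid_processes_def)
  have "N.prob (\<Inter>i\<in>{..<n}. E i) = (\<Prod>i\<in>{..<n}. N.prob (E i))"
    unfolding EB using indep B' \<open>n > 0\<close> by (intro N.indep_varsD) auto
  also have "\<dots> = (\<Prod>i\<in>{..<n}. N.prob (E 0))" by (intro prod.cong refl eq) simp
  also have "N.prob (\<Inter>i\<in>{..<n}. E i) = 0"
  proof -
    have "AE \<omega> in N. \<omega> \<notin> (\<Inter>i\<in>{..<n}. E i)" using AE by eventually_elim (auto simp: E_def)
    moreover have "(\<Inter>i\<in>{..<n}. E i) \<in> sets N" using E \<open>n > 0\<close> by (intro sets.finite_INT) auto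
    ultimately show ?thesis by (subst N.prob_eq_0) auto
  qed
  finally have "N.prob (E 0) = 0" using \<open>n > 0\<close> by simp
  then have "AE \<omega> in N. \<omega> \<notin> E 0" using E[OF \<open>n > 0\<close>] by (simp add: N.prob_eq_0)
  then show ?thesis using AE_space by eventually_elim (auto simp: E_def)
qed

lemma rpow_prod:
  assumes "\<And>i. i \<in> A \<Longrightarrow> 0 \<le> u i"
  shows "rpow z (\<Prod>i\<in>A. u i) = (\<Prod>i\<in>A. rpow z (u i))"
  using assms by (induction A rule: infinite_finite_induct) (auto simp: rpow_def powr_mult prod_nonneg)

lemma sum_ereal_less_0:
  fixes x :: "nat \<Rightarrow> ereal"
  assumes "n > 0" "\<And>i. i < n \<Longrightarrow> x i < 0"
  shows "(\<Sum>i<n. x i) < 0"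
  using assms
proof (induction n)
  case (Suc n)
  have neg: "a < 0 \<Longrightarrow> b < 0 \<Longrightarrow> a + b < 0" for a b :: ereal by (cases a; cases b) auto
  show ?case
  proof (cases "n = 0")
    case False
    with Suc have "(\<Sum>i<n. x i) < 0" "x n < 0" by auto
    then show ?thesis by (simp add: neg)
  qed (use Suc in auto)
qed simp

lemma sum_ereal_strict_mono:
  fixes x :: "nat \<Rightarrow> ereal"
  assumes "n > 0" "\<And>i. i < n \<Longrightarrow> x i < y i" "\<And>i. i < n \<Longrightarrow> 0 \<le> x i"
  shows "(\<Sum>i<n. x i) < (\<Sum>i<n. y i)"
  using assms
proof (induction n)
  case (Suc n)
  show ?case
  proof (cases "n = 0")
    case False
    with Suc have "(\<Sum>i<n. x i) < (\<Sum>i<n. y i)" "x n < y n" by auto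
    then show ?thesis by (auto intro: ereal_add_strict_mono2)
  qed (use Suc in auto)
qed simp

text \<open>What is kept of an \<open>n\<close>-th convolution root. Sign and monotonicity are
  required only for fixed times, up to null sets depending on them, since a root comes without path
  regularity.\<close>

definition laplace_root ::
  "'a measure \<Rightarrow> (real \<Rightarrow> 'a \<Rightarrow> ereal) \<Rightarrow> nat \<Rightarrow> 'b measure \<Rightarrow> (real \<Rightarrow> 'b \<Rightarrow> ereal) \<Rightarrow> bool" where
  "laplace_root M H n N Y \<longleftrightarrow> prob_space N \<and> (\<forall>t. Y t \<in> borel_measurable N) \<and>
    (\<forall>t. AE \<omega> in N. 0 \<le> Y t \<omega>) \<and> (\<forall>s t. s \<le> t \<longrightarrow> (AE \<omega> in N. Y s \<omega> \<le> Y t \<omega>)) \<and>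
    (\<forall>(d::nat) z t. (\<forall>i<d. 0 \<le> z i) \<longrightarrow>
       (\<integral>\<omega>. exp_minus (\<Sum>i<d. ereal (z i) * H (t i) \<omega>) \<partial>M) =
       (\<integral>\<omega>. exp_minus (\<Sum>i<d. ereal (z i) * Y (t i) \<omega>) \<partial>N) ^ n)"

text \<open>A single summand is the root. If it were negative at some time, or decreasing between
  two times, with positive probability, then by independence all \<open>n\<close> summands would be
  so at once, and the same would hold for their sum, which has the law of \<open>H\<close>.\<close>

lemma id_process_root:
  assumes id: "id_process M H" and nonneg: "\<And>t. AE \<omega> in M. 0 \<le> H t \<omega>"
    and mono: "\<And>s t. s \<le> t \<Longrightarrow> AE \<omega> in M. H s \<omega> \<le> H t \<omega>" and n: "n > 0"
  shows "\<exists>(N :: (nat \<Rightarrow> real \<Rightarrow> ereal) measure) Y. laplace_root M H n N Y"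
proof -
  from id n obtain N :: "(nat \<Rightarrow> real \<Rightarrow> ereal) measure" and X where
    iid: "iid_processes N n X" and fdd: "same_fdd M H N (\<lambda>t \<omega>. \<Sum>i<n. X i t \<omega>)"
    unfolding id_process_def by blast
  have sp: "stoch_process N (X i)" if "i < n" for i using iid that by (simp add: iid_processes_def)
  have X [measurable]: "X i t \<in> borel_measurable N" if "i < n" for i t
    using sp[OF that] by (simp add: stoch_process_def)
  interpret N: prob_space N using sp[OF n] by (simp add: stoch_process_def)
  have spH: "stoch_process M H" using id by (simp add: id_process_def)
  have spS: "stoch_process N (\<lambda>t \<omega>. \<Sum>i<n. X i t \<omega>)"
    using N.prob_space_axioms by (auto simp: stoch_process_def)
  have fdd': "same_fdd N (X i) N (X 0)" if "i < n" for i
    using iid that n by (simp add: iid_processes_def)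
  have C [measurable]: "(\<lambda>f. f t) \<in> borel_measurable (Pi\<^sub>M J (\<lambda>_. borel :: ereal measure))" if "t \<in> J" for t :: real and J
    using that by (rule measurable_component_singleton)
  have nonneg0: "AE \<omega> in N. 0 \<le> X 0 t \<omega>" for t
  proof -
    let ?P = "Pi\<^sub>M {t} (\<lambda>_. borel :: ereal measure)"
    have "{f \<in> space ?P. 0 \<le> f t} \<in> sets ?P" by measurable auto
    from same_fdd_AE[OF fdd spH spS _ this] nonneg[of t] have "AE \<omega> in N. 0 \<le> (\<Sum>i<n. X i t \<omega>)"
      by (simp add: space_PiM)
    then have "AE \<omega> in N. \<not> (\<forall>i<n. (\<lambda>t\<in>{t}. X i t \<omega>) \<in> {f \<in> space ?P. f t < 0})"
    proof eventually_elim
      case (elim \<omega>)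
      show ?case
      proof
        assume "\<forall>i<n. (\<lambda>t\<in>{t}. X i t \<omega>) \<in> {f \<in> space ?P. f t < 0}"
        then have "(\<Sum>i<n. X i t \<omega>) < 0"
          using elim by (intro sum_ereal_less_0[OF n]) auto
        with elim show False by simp
      qed
    qed
    moreover have "{f \<in> space ?P. f t < 0} \<in> sets ?P" by measurable auto
    ultimately have "AE \<omega> in N. (\<lambda>t\<in>{t}. X 0 t \<omega>) \<notin> {f \<in> space ?P. f t < 0}"
      using iid n by (intro iid_processes_not_simultaneous) auto
    then show ?thesis by (simp add: space_PiM not_less)
  qed
  have nonnegX: "AE \<omega> in N. 0 \<le> X i t \<omega>" if "i < n" for i t
  proof -
    let ?P = "Pi\<^sub>M {t} (\<lambda>_. borel :: ereal measure)"
    have "{f \<in> space ?P. 0 \<le> f t} \<in> sets ?P" by measurable auto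
    from same_fdd_AE[OF fdd'[OF that] sp[OF that] sp[OF n] _ this] nonneg0[of t] show ?thesis
      by (simp add: space_PiM)
  qed
  have mono0: "AE \<omega> in N. X 0 s \<omega> \<le> X 0 t \<omega>" if "s \<le> t" for s t
  proof -
    let ?P = "Pi\<^sub>M {s, t} (\<lambda>_. borel :: ereal measure)"
    have "{f \<in> space ?P. f s \<le> f t} \<in> sets ?P" by (intro borel_measurable_le C) auto
    from same_fdd_AE[OF fdd spH spS _ this] mono[OF that]
    have 1: "AE \<omega> in N. (\<Sum>i<n. X i s \<omega>) \<le> (\<Sum>i<n. X i t \<omega>)"
      by (simp add: space_PiM)
    \<comment> \<open>Non-negativity comes first: it makes the smaller terms finite and
      non-negative, so that strict inequalities add up in \<open>ereal\<close>.\<close>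
    have 2: "AE \<omega> in N. \<forall>i<n. 0 \<le> X i t \<omega>"
      using nonnegX by (simp add: AE_all_countable[where 'i = nat, simplified] )
    from 1 2 have "AE \<omega> in N. \<not> (\<forall>i<n. (\<lambda>t\<in>{s, t}. X i t \<omega>) \<in> {f \<in> space ?P. f t < f s})"
    proof eventually_elim
      case (elim \<omega>)
      show ?case
      proof
        assume "\<forall>i<n. (\<lambda>t\<in>{s, t}. X i t \<omega>) \<in> {f \<in> space ?P. f t < f s}"
        then have "(\<Sum>i<n. X i t \<omega>) < (\<Sum>i<n. X i s \<omega>)"
          using elim by (intro sum_ereal_strict_mono[OF n]) auto
        with elim show False by simp
      qed
    qed
    moreover have "{f \<in> space ?P. f t < f s} \<in> sets ?P" by (intro borel_measurable_less C) auto
    ultimately have "AE \<omega> in N. (\<lambda>t\<in>{s, t}. X 0 t \<omega>) \<notin> {f \<in> space ?P. f t < f s}"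
      using iid n by (intro iid_processes_not_simultaneous) auto
    then show ?thesis by (simp add: space_PiM not_less)
  qed
  have "(\<integral>\<omega>. exp_minus (\<Sum>i<d. ereal (z i) * H (t i) \<omega>) \<partial>M) =
       (\<integral>\<omega>. exp_minus (\<Sum>i<d. ereal (z i) * X 0 (t i) \<omega>) \<partial>N) ^ n"
    if z: "\<forall>i<d. 0 \<le> z i" for d :: nat and z t :: "nat \<Rightarrow> real"
  proof -
    \<comment> \<open>In product form the Laplace functional depends on finitely many coordinates,
      so equality of finite-dimensional laws applies, and it factorizes over independent
      summands.\<close>
    define F where "F f = (\<Prod>j<d. rpow (z j) (exp_minus (f (t j))))" for f :: "real \<Rightarrow> ereal"
    define J where "J = t ` {..<d}"
    have FJ: "F (\<lambda>t\<in>J. f t) = F f" for f unfolding F_def J_def by (intro prod.cong) auto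
    have F: "F \<in> borel_measurable (Pi\<^sub>M K (\<lambda>_. borel))" if "J \<subseteq> K" for K
      unfolding F_def
    proof (intro borel_measurable_prod)
      fix i assume "i \<in> {..<d}"
      then have "t i \<in> K" using that by (auto simp: J_def)
      then show "(\<lambda>f. rpow (z i) (exp_minus (f (t i)))) \<in> borel_measurable (Pi\<^sub>M K (\<lambda>_. borel))"
        by (intro measurable_compose[OF C measurable_compose[OF measurable_exp_minus measurable_rpow]])
    qed
    have F01: "0 \<le> F f \<and> F f \<le> 1" if "\<forall>i<d. 0 \<le> f (t i)" for f
    proof -
      have "0 \<le> rpow (z i) (exp_minus (f (t i))) \<and> rpow (z i) (exp_minus (f (t i))) \<le> 1" if "i < d" for i
        using z that \<open>\<forall>i<d. 0 \<le> f (t i)\<close> by (simp add: rpow_bounds exp_minus_bounds)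
      then show ?thesis unfolding F_def by (auto intro!: prod_nonneg prod_le_1)
    qed
    have FX: "(\<lambda>\<omega>. F (\<lambda>t. X i t \<omega>)) \<in> borel_measurable N" if "i < n" for i
      by (rule measurable_compose[OF _ F[of UNIV]]) (auto intro!: measurable_PiM_single' simp: that)
    have all: "AE \<omega> in N. \<forall>i<n. \<forall>j<d. 0 \<le> X i (t j) \<omega>"
      using nonnegX by (simp add: AE_all_countable)
    have H0: "AE \<omega> in M. \<forall>j<d. 0 \<le> H (t j) \<omega>"
      using nonneg by (simp add: AE_all_countable)
    have "(\<integral>\<omega>. exp_minus (\<Sum>i<d. ereal (z i) * H (t i) \<omega>) \<partial>M) = (\<integral>\<omega>. F (\<lambda>t\<in>J. H t \<omega>) \<partial>M)"
    proof (rule integral_cong_AE)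
      show "(\<lambda>\<omega>. F (\<lambda>t\<in>J. H t \<omega>)) \<in> borel_measurable M"
        by (rule measurable_compose[OF stoch_process_measurable_restrict[OF spH] F]) simp
      have [measurable]: "H t \<in> borel_measurable M" for t using spH by (simp add: stoch_process_def)
      show "(\<lambda>\<omega>. exp_minus (\<Sum>i<d. ereal (z i) * H (t i) \<omega>)) \<in> borel_measurable M" by measurable
      show "AE \<omega> in M. exp_minus (\<Sum>i<d. ereal (z i) * H (t i) \<omega>) = F (\<lambda>t\<in>J. H t \<omega>)"
        unfolding FJ using H0
        by eventually_elim (use z in \<open>simp add: exp_minus_weighted_sum F_def\<close>)
    qed
    also have "\<dots> = (\<integral>\<omega>. F (\<lambda>t\<in>J. \<Sum>i<n. X i t \<omega>) \<partial>N)"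
      by (rule same_fdd_integral[OF fdd spH spS _ F]) (auto simp: J_def)
    also have "\<dots> = (\<integral>\<omega>. (\<Prod>i<n. F (\<lambda>t. X i t \<omega>)) \<partial>N)"
    proof (rule integral_cong_AE)
      show "(\<lambda>\<omega>. F (\<lambda>t\<in>J. \<Sum>i<n. X i t \<omega>)) \<in> borel_measurable N"
        by (rule measurable_compose[OF stoch_process_measurable_restrict[OF spS] F]) simp
      show "(\<lambda>\<omega>. \<Prod>i<n. F (\<lambda>t. X i t \<omega>)) \<in> borel_measurable N"
        using FX by (intro borel_measurable_prod) auto
      show "AE \<omega> in N. F (\<lambda>t\<in>J. \<Sum>i<n. X i t \<omega>) = (\<Prod>i<n. F (\<lambda>t. X i t \<omega>))"
        using all
      proof eventually_elim
        case (elim \<omega>)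
        then show ?case
          unfolding FJ unfolding F_def
          by (subst prod.swap, intro prod.cong refl, subst exp_minus_sum, simp, subst rpow_prod)
            (auto simp: exp_minus_bounds)
      qed
    qed
    also have "\<dots> = (\<Prod>i<n. \<integral>\<omega>. F (\<lambda>t. X i t \<omega>) \<partial>N)"
    proof (rule N.indep_vars_lebesgue_integral)
      have "N.indep_vars (\<lambda>_. Pi\<^sub>M UNIV (\<lambda>_. borel)) (\<lambda>i \<omega> t. X i t \<omega>) {..<n}"
        using iid by (simp add: iid_processes_def)
      then show "N.indep_vars (\<lambda>_. borel) (\<lambda>i \<omega>. F (\<lambda>t. X i t \<omega>)) {..<n}"
        by (rule N.indep_vars_compose2) (auto intro: F)
      fix i assume i: "i \<in> {..<n}"
      have "AE \<omega> in N. norm (F (\<lambda>t. X i t \<omega>)) \<le> 1"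
        using all by eventually_elim (use F01 i in auto)
      then show "integrable N (\<lambda>\<omega>. F (\<lambda>t. X i t \<omega>))"
        using FX i by (intro N.integrable_const_bound) auto
    qed simp
    also have "\<dots> = (\<Prod>i<n. \<integral>\<omega>. F (\<lambda>t. X 0 t \<omega>) \<partial>N)"
    proof (rule prod.cong)
      fix i assume "i \<in> {..<n}"
      then have "(\<integral>\<omega>. F (\<lambda>t\<in>J. X i t \<omega>) \<partial>N) = (\<integral>\<omega>. F (\<lambda>t\<in>J. X 0 t \<omega>) \<partial>N)"
        using n by (intro same_fdd_integral fdd' sp F) (auto simp: J_def)
      then show "(\<integral>\<omega>. F (\<lambda>t. X i t \<omega>) \<partial>N) = (\<integral>\<omega>. F (\<lambda>t. X 0 t \<omega>) \<partial>N)"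
        unfolding FJ .
    qed simp
    also have "(\<integral>\<omega>. F (\<lambda>t. X 0 t \<omega>) \<partial>N) = (\<integral>\<omega>. exp_minus (\<Sum>i<d. ereal (z i) * X 0 (t i) \<omega>) \<partial>N)"
    proof (rule integral_cong_AE)
      have [measurable]: "X 0 t \<in> borel_measurable N" for t using X n by simp
      show "(\<lambda>\<omega>. exp_minus (\<Sum>i<d. ereal (z i) * X 0 (t i) \<omega>)) \<in> borel_measurable N" by measurable
      show "AE \<omega> in N. F (\<lambda>t. X 0 t \<omega>) = exp_minus (\<Sum>i<d. ereal (z i) * X 0 (t i) \<omega>)"
        using all by eventually_elim (use z n in \<open>simp add: exp_minus_weighted_sum F_def\<close>)
    qed (rule FX[OF n])
    finally show ?thesis by simp
  qed
  then show ?thesis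
    using N.prob_space_axioms X[OF n] nonneg0 mono0 by (intro exI[of _ N] exI[of _ "X 0"]) (simp add: laplace_root_def)
qed

section \<open>Compactness of the rescaled roots\<close>

text \<open>The sequence is minus the difference quotient of \<open>h \<mapsto> p powr h\<close> at
  0, taken along \<open>h = 1 / Suc n\<close>.\<close>

lemma root_limit:
  assumes p: "0 < p" and r: "\<And>n. 0 \<le> r n" "\<And>n. r n ^ Suc n = p"
  shows "(\<lambda>n. real (Suc n) * (1 - r n)) \<longlonglongrightarrow> - ln p"
proof -
  have r_eq: "r n = p powr (1 / real (Suc n))" for n
  proof -
    have "r n > 0" using r(1)[of n] r(2)[of n] p by (cases "r n = 0") auto
    then have "r n = (r n powr real (Suc n)) powr (1 / real (Suc n))"
      by (subst powr_powr) simp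
    also have "r n powr real (Suc n) = p" using \<open>r n > 0\<close> r(2)[of n] by (subst powr_realpow) auto
    finally show ?thesis .
  qed
  have "((\<lambda>h. p powr h) has_real_derivative ln p) (at 0)"
    using p by (auto intro!: derivative_eq_intros)
  then have "((\<lambda>h. (p powr h - 1) / h) \<longlongrightarrow> ln p) (at 0)"
    using p by (simp add: DERIV_def)
  moreover have "filterlim (\<lambda>n. 1 / real (Suc n)) (at 0) sequentially"
    unfolding filterlim_at using LIMSEQ_Suc[OF lim_1_over_n] by (auto intro!: always_eventually) 
  ultimately have "(\<lambda>n. (p powr (1 / real (Suc n)) - 1) / (1 / real (Suc n))) \<longlonglongrightarrow> ln p"
    by (rule filterlim_compose)
  from tendsto_minus[OF this] show ?thesis
    unfolding r_eq by (simp add: algebra_simps)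
qed

text \<open>The non-asymptotic companion of the limit, from \<open>ln r \<le> r - 1\<close>; its
  uniformity in \<open>n\<close> bounds the total masses.\<close>

lemma root_defect_le:
  assumes p: "0 < p" and r: "0 \<le> r" "r ^ Suc n = p"
  shows "real (Suc n) * (1 - r) \<le> - ln p"
proof -
  have "r > 0" using r p by (cases "r = 0") auto
  then have "ln r \<le> r - 1" by (rule ln_le_minus_one)
  then have "real (Suc n) * ln r \<le> real (Suc n) * (r - 1)" by (intro mult_left_mono) auto
  moreover have "ln p = real (Suc n) * ln r" using \<open>r > 0\<close> r(2) using ln_realpow[of r "Suc n"] by simp
  ultimately show ?thesis by (simp add: algebra_simps)
qed

text \<open>Inequalities between coordinates survive the limit as the vanishing of non-negative
  continuous functions, and the Laplace exponent survives as the integral of a bounded continuous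
  kernel. The measure \<open>L\<close> is a law of codes, from which \<open>w\<close> and
  \<open>y\<close> are decoded.\<close>

lemma limit_representation:
  fixes M :: "'a measure" and q :: "nat \<Rightarrow> real"
  assumes id: "id_process M H" and nonneg: "\<And>t. AE \<omega> in M. 0 \<le> H t \<omega>"
    and mono: "\<And>s t. s \<le> t \<Longrightarrow> AE \<omega> in M. H s \<omega> \<le> H t \<omega>"
    and pos: "\<And>d z t. (\<forall>i<d. 0 \<le> z i) \<Longrightarrow> 0 < (\<integral>\<omega>. exp_minus (\<Sum>i<d::nat. ereal (z i) * H (t i) \<omega>) \<partial>M)"
  obtains L :: "real measure" and w y B where
    "prob_space L" "w \<in> borel_measurable L" "\<forall>k. y k \<in> borel_measurable L"
    "\<forall>s. 0 \<le> w s" "\<forall>k s. 0 \<le> y k s" "\<forall>k s. y k s \<le> B k"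
    "AE s in L. \<forall>k. w s * y k s \<le> 1"
    "AE s in L. \<forall>k l. q k \<le> q l \<longrightarrow> y k s \<le> y l s"
    "\<forall>(d::nat) z \<kappa>. (\<forall>i<d. 0 \<le> z i) \<longrightarrow>
      - ln (\<integral>\<omega>. exp_minus (\<Sum>i<d. ereal (z i) * H (q (\<kappa> i)) \<omega>) \<partial>M) =
      (\<integral>s. levy_kernel d z (w s) (\<lambda>i. y (\<kappa> i) s) \<partial>L)"
proof -
  have "\<forall>n. \<exists>(N :: (nat \<Rightarrow> real \<Rightarrow> ereal) measure) Y. laplace_root M H (Suc n) N Y"
    using id_process_root[OF id nonneg mono] by simp
  then obtain N :: "nat \<Rightarrow> (nat \<Rightarrow> real \<Rightarrow> ereal) measure" and Y where
    NY: "\<And>n. laplace_root M H (Suc n) (N n) (Y n)"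
    by metis
  then have N: "\<And>n. prob_space (N n)" and Ym [measurable]: "\<And>n t. Y n t \<in> borel_measurable (N n)"
    and Y0: "\<And>n t. AE \<omega> in N n. 0 \<le> Y n t \<omega>"
    and Ymono: "\<And>n s t. s \<le> t \<Longrightarrow> AE \<omega> in N n. Y n s \<omega> \<le> Y n t \<omega>"
    by (simp_all add: laplace_root_def)
  have root: "(\<integral>\<omega>. exp_minus (\<Sum>i<d. ereal (z i) * H (t i) \<omega>) \<partial>M) =
      (\<integral>\<omega>. exp_minus (\<Sum>i<d. ereal (z i) * Y n (t i) \<omega>) \<partial>N n) ^ Suc n"
    if "\<forall>i<d. 0 \<le> z i" for n and d :: nat and z t
    using NY[of n] that unfolding laplace_root_def by blast
  interpret N: prob_space "N n" for n by (rule N)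

  define p where "p k = (\<integral>\<omega>. exp_minus (H (q k) \<omega>) \<partial>M)" for k
  have p_pos: "0 < p k" for k using pos[of 1 "\<lambda>_. 1" "\<lambda>_. q k"] by (simp add: p_def flip: one_ereal_def)
  \<comment> \<open>These weights make both \<open>W\<close> and the total masses \<open>(n + 1) E[W]\<close> at most 1.\<close>
  define a where "a k = (1/2) ^ Suc k / (1 + \<bar>ln (p k)\<bar>)" for k
  have a_pos: "0 < a k" for k unfolding a_def by (intro divide_pos_pos) auto
  have a_le: "a k \<le> (1/2) ^ Suc k" for k unfolding a_def by (simp add: divide_le_eq)
  have a_le': "a k * - ln (p k) \<le> (1/2) ^ Suc k" for k
  proof -
    have "a k * - ln (p k) \<le> a k * (1 + \<bar>ln (p k)\<bar>)" using a_pos[of k] by (intro mult_left_mono) auto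
    also have "\<dots> = (1/2) ^ Suc k"
      unfolding a_def by (rule iffD1[OF nonzero_divide_eq_eq refl, symmetric]) linarith
    finally show ?thesis .
  qed
  have half: "(\<lambda>k. (1/2 :: real) ^ Suc k) sums 1" by (rule power_half_series)

  \<comment> \<open>The truncation by \<open>max 0\<close> puts the values in \<open>[0, 1]\<close>
    everywhere, not just almost surely, as the coding requires.\<close>
  define u where "u n k \<omega> = 1 - exp_minus (max 0 (Y n (q k) \<omega>))" for n k \<omega>
  have [measurable]: "u n k \<in> borel_measurable (N n)" for n k unfolding u_def by measurable
  have u01: "0 \<le> u n k \<omega>" "u n k \<omega> \<le> 1" for n k \<omega>
    using exp_minus_bounds[of "max 0 (Y n (q k) \<omega>)"] by (auto simp: u_def)
  define W where "W n \<omega> = (\<Sum>k. a k * u n k \<omega>)" for n \<omega>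
  have au: "0 \<le> a k * u n k \<omega>" "a k * u n k \<omega> \<le> (1/2) ^ Suc k" for n k \<omega>
    using a_pos[of k] u01[of n k \<omega>] a_le[of k] mult_mono[of "a k" "(1/2) ^ Suc k" "u n k \<omega>" 1] by auto
  have summ: "summable (\<lambda>k. a k * u n k \<omega>)" for n \<omega>
  proof (rule summable_comparison_test')
    show "summable (\<lambda>k. (1/2 :: real) ^ Suc k)" using half by (rule sums_summable)
    show "norm (a k * u n k \<omega>) \<le> (1/2) ^ Suc k" for k using au[of k n \<omega>] by simp
  qed
  have W0: "0 \<le> W n \<omega>" for n \<omega> unfolding W_def by (intro suminf_nonneg summ au)
  have W1: "W n \<omega> \<le> 1" for n \<omega>
    using sums_le[OF au(2) summable_sums[OF summ] half] by (simp only: W_def)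
  have auW: "a k * u n k \<omega> \<le> W n \<omega>" for n k \<omega>
    unfolding W_def using sum_le_suminf[OF summ, of "{k}"] au(1) by auto
  \<comment> \<open>If \<open>W\<close> vanishes, then so does every \<open>u\<close>, because all
    weights are positive; the convention \<open>x / 0 = 0\<close> is then harmless.\<close>
  have uW: "W n \<omega> * (u n k \<omega> / W n \<omega>) = u n k \<omega>" for n k \<omega>
    using auW[of k n \<omega>] a_pos[of k] u01[of n k \<omega>]
    by (cases "W n \<omega> = 0") (auto simp: mult_le_0_iff)
  have [measurable]: "W n \<in> borel_measurable (N n)" for n unfolding W_def by measurable
  have int_W: "integrable (N n) (W n)" for n
    using W0 W1 by (intro N.integrable_const_bound[where B = 1]) auto
  have int_u: "integrable (N n) (u n k)" for n k
    using u01 by (intro N.integrable_const_bound[where B = 1]) auto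

  have Eu: "real (Suc n) * (\<integral>\<omega>. u n k \<omega> \<partial>N n) \<le> - ln (p k)" for n k
  proof -
    have "(\<integral>\<omega>. u n k \<omega> \<partial>N n) = (\<integral>\<omega>. 1 - exp_minus (Y n (q k) \<omega>) \<partial>N n)"
      by (rule integral_cong_AE) (use Y0[of n "q k"] in \<open>auto simp: u_def max_def elim: eventually_mono\<close>)
    also have "\<dots> = 1 - (\<integral>\<omega>. exp_minus (Y n (q k) \<omega>) \<partial>N n)"
    proof (subst Bochner_Integration.integral_diff)
      have "AE \<omega> in N n. norm (exp_minus (Y n (q k) \<omega>)) \<le> 1"
        using Y0[of n "q k"] by eventually_elim (auto simp: exp_minus_bounds)
      then show "integrable (N n) (\<lambda>\<omega>. exp_minus (Y n (q k) \<omega>))"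
        by (rule N.integrable_const_bound) simp
    qed (auto simp: N.prob_space)
    finally have *: "(\<integral>\<omega>. u n k \<omega> \<partial>N n) = 1 - (\<integral>\<omega>. exp_minus (Y n (q k) \<omega>) \<partial>N n)" .
    show ?thesis
      unfolding *
    proof (rule root_defect_le[OF p_pos])
      show "(\<integral>\<omega>. exp_minus (Y n (q k) \<omega>) \<partial>N n) ^ Suc n = p k"
        using root[of 1 "\<lambda>_. 1" "\<lambda>_. q k" n] by (simp add: p_def flip: one_ereal_def)
      show "0 \<le> (\<integral>\<omega>. exp_minus (Y n (q k) \<omega>) \<partial>N n)"
        using Y0[of n "q k"] by (intro integral_nonneg_AE) (auto simp: exp_minus_bounds)
    qed
  qed
  have EW: "real (Suc n) * (\<integral>\<omega>. W n \<omega> \<partial>N n) \<le> 1" for n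
  proof -
    have s1: "summable (\<lambda>k. \<integral>\<omega>. norm (a k * u n k \<omega>) \<partial>N n)"
    proof (rule summable_comparison_test'[where g = "\<lambda>k. (1/2) ^ Suc k"])
      show "summable (\<lambda>k. (1/2 :: real) ^ Suc k)" using half by (rule sums_summable)
      fix k
      have "(\<integral>\<omega>. norm (a k * u n k \<omega>) \<partial>N n) \<le> (\<integral>\<omega>. (1/2) ^ Suc k \<partial>N n)"
        using int_u au by (intro integral_mono) auto
      then show "norm (\<integral>\<omega>. norm (a k * u n k \<omega>) \<partial>N n) \<le> (1/2) ^ Suc k"
        by (simp add: N.prob_space)
    qed
    have "(\<lambda>k. \<integral>\<omega>. a k * u n k \<omega> \<partial>N n) sums (\<integral>\<omega>. W n \<omega> \<partial>N n)"
      unfolding W_def using summ au(1) int_u s1 by (intro sums_integral) auto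
    then have s: "(\<lambda>k. real (Suc n) * (\<integral>\<omega>. a k * u n k \<omega> \<partial>N n)) sums (real (Suc n) * (\<integral>\<omega>. W n \<omega> \<partial>N n))"
      by (rule sums_mult)
    have "real (Suc n) * (\<integral>\<omega>. a k * u n k \<omega> \<partial>N n) \<le> (1/2) ^ Suc k" for k
    proof -
      have "real (Suc n) * (\<integral>\<omega>. a k * u n k \<omega> \<partial>N n) = a k * (real (Suc n) * (\<integral>\<omega>. u n k \<omega> \<partial>N n))"
        by simp
      also have "\<dots> \<le> a k * - ln (p k)" using Eu a_pos by (intro mult_left_mono) (auto intro: less_imp_le)
      finally show ?thesis using a_le'[of k] by linarith
    qed
    from sums_le[OF this s half] show ?thesis .
  qed

  \<comment> \<open>The root index is \<open>Suc n\<close>, which is therefore the scaling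
    factor.\<close>
  define g where "g n \<omega> = real (Suc n) * W n \<omega>" for n \<omega>
  have g: "integrable (N n) (g n)" "\<And>\<omega>. 0 \<le> g n \<omega>" "integral\<^sup>L (N n) (g n) \<le> 1" for n
    using int_W[of n] W0[of n] EW[of n] unfolding g_def by auto
  define P where "P n = density (N n \<Otimes>\<^sub>M count_space (UNIV :: bool set))
    (\<lambda>(\<omega>, b). ennreal (if b then g n \<omega> else 1 - integral\<^sup>L (N n) (g n)))" for n
  note P_prob = prob_space_density_with_atom(1)[OF N g, folded P_def]
  note P_int = prob_space_density_with_atom(2)[OF N g, folded P_def]
  \<comment> \<open>Coordinate 0 is the weight; coordinate \<open>Suc k\<close> is the slope
    \<open>u / W\<close> multiplied by \<open>a k\<close>, which brings it into
    \<open>[0, 1]\<close>. The added atom sits at the zero sequence.\<close>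
  define V where "V n k x = (if snd x then (case k of 0 \<Rightarrow> W n (fst x) | Suc k \<Rightarrow> a k * (u n k (fst x) / W n (fst x))) else 0)"
    for n k and x :: "(nat \<Rightarrow> real \<Rightarrow> ereal) \<times> bool"
  have V: "V n k \<in> borel_measurable (P n)" for n k
    unfolding V_def P_def by (cases k) auto
  have V01: "0 \<le> V n k x \<and> V n k x \<le> 1" for n k x
  proof (cases k)
    case (Suc j)
    have "a j * u n j (fst x) / W n (fst x) \<le> 1"
      using auW[of j n "fst x"] W0[of n "fst x"] by (auto simp: divide_le_eq)
    then show ?thesis using Suc a_pos[of j] u01[of n j "fst x"] W0[of n "fst x"] by (auto simp: V_def)
  qed (auto simp: V_def W0 W1)
  have V_False: "V n k (\<omega>, False) = 0" for n k \<omega> by (simp add: V_def)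
  have V_0: "V n 0 (\<omega>, True) = W n \<omega>" for n \<omega> by (simp add: V_def)
  have V_Suc: "V n (Suc k) (\<omega>, True) / a k = u n k \<omega> / W n \<omega>" for n k \<omega>
    using a_pos[of k] by (simp add: V_def)
  obtain r L where r: "strict_mono r" and L: "real_distribution L"
    and lim: "\<And>(f :: (nat \<Rightarrow> real) \<Rightarrow> real) C. continuous_on UNIV (\<lambda>s. f (\<lambda>k. decode k s)) \<Longrightarrow> (\<And>s. \<bar>f (\<lambda>k. decode k s)\<bar> \<le> C) \<Longrightarrow>
       (\<lambda>n. \<integral>\<omega>. f (\<lambda>k. V (r n) k \<omega>) \<partial>P (r n)) \<longlonglongrightarrow> (\<integral>s. f (\<lambda>k. decode k s) \<partial>L)"
    using random_sequences_convergent_subsequence[of P V, OF P_prob V V01] by blast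
  interpret L: real_distribution L by fact
  have dec [measurable]: "decode k \<in> borel_measurable borel" for k
    by (rule borel_measurable_continuous_onI[OF continuous_decode])
  have dec_at: "(decode k \<longlongrightarrow> decode k s) (at s)" for k s
    using continuous_decode[of k] by (auto simp: continuous_on_def)
  define w where "w = decode 0"
  define y where "y k s = decode (Suc k) s / a k" for k s
  have wb: "0 \<le> w s" "w s \<le> 1" for s using decode_bounds by (auto simp: w_def)
  have yb: "0 \<le> y k s \<and> y k s \<le> 1 / a k" for k s
    using decode_bounds[of "Suc k" s] a_pos[of k] by (auto simp: y_def divide_right_mono)
  \<comment> \<open>The integral of such an \<open>f\<close> is 0 for every \<open>n\<close>, hence
    0 in the limit, and a non-negative function with integral 0 vanishes almost everywhere. The
    condition \<open>f0\<close> takes care of the atom.\<close>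
  have closed: "AE s in L. f (\<lambda>k. decode k s) = 0"
    if c: "continuous_on UNIV (\<lambda>s. f (\<lambda>k. decode k s))" and b: "\<And>s. 0 \<le> f (\<lambda>k. decode k s)" "\<And>s. f (\<lambda>k. decode k s) \<le> C"
      and fm: "\<And>n. (\<lambda>x. f (\<lambda>k. V n k x)) \<in> borel_measurable (P n)"
      and f0: "f (\<lambda>_. 0) = 0" and fV: "\<And>n. AE \<omega> in N n. f (\<lambda>k. V n k (\<omega>, True)) = 0"
    for f :: "(nat \<Rightarrow> real) \<Rightarrow> real" and C
  proof -
    have "(\<integral>x. f (\<lambda>k. V n k x) \<partial>P n) = 0" for n
    proof -
      have "(\<integral>x. f (\<lambda>k. V n k x) \<partial>P n) = (\<integral>\<omega>. g n \<omega> * f (\<lambda>k. V n k (\<omega>, True)) \<partial>N n)"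
        by (rule P_int[OF fm]) (simp add: V_False f0)
      also have "\<dots> = 0" by (rule integral_eq_zero_AE) (use fV[of n] in \<open>auto elim: eventually_mono\<close>)
      finally show ?thesis .
    qed
    moreover have "(\<lambda>n. \<integral>x. f (\<lambda>k. V (r n) k x) \<partial>P (r n)) \<longlonglongrightarrow> (\<integral>s. f (\<lambda>k. decode k s) \<partial>L)"
      by (rule lim[OF c, of C]) (use b in auto)
    ultimately have "(\<integral>s. f (\<lambda>k. decode k s) \<partial>L) = 0"
      by (simp add: LIMSEQ_const_iff)
    moreover have "integrable L (\<lambda>s. f (\<lambda>k. decode k s))"
      using b borel_measurable_continuous_onI[OF c] by (intro L.integrable_const_bound[where B = C]) auto
    ultimately show ?thesis
      using b by (subst (asm) integral_nonneg_eq_0_iff_AE) auto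
  qed

  have le1: "AE s in L. \<forall>k. w s * y k s \<le> 1"
    unfolding AE_all_countable
  proof
    fix k
    \<comment> \<open>The excess over 1 is tested; before the limit the product of weight and slope
      is \<open>u\<close>, which is at most 1.\<close>
    have "AE s in L. max 0 (decode 0 s * (decode (Suc k) s / a k) - 1) = 0"
    proof (rule closed[of "\<lambda>v. max 0 (v 0 * (v (Suc k) / a k) - 1)" "1 / a k"])
      show "continuous_on UNIV (\<lambda>s. max 0 (decode 0 s * (decode (Suc k) s / a k) - 1))"
        using a_pos[of k] by (intro continuous_intros continuous_decode) simp
      show "max 0 (decode 0 s * (decode (Suc k) s / a k) - 1) \<le> 1 / a k" for s
        using mult_mono[of "w s" 1 "y k s" "1 / a k"] wb[of s] yb[of k s] a_pos[of k]
        by (auto simp: w_def y_def)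
      show "(\<lambda>x. max 0 (V n 0 x * (V n (Suc k) x / a k) - 1)) \<in> borel_measurable (P n)" for n
        using V by measurable
      show "AE \<omega> in N n. max 0 (V n 0 (\<omega>, True) * (V n (Suc k) (\<omega>, True) / a k) - 1) = 0" for n
        unfolding V_0 V_Suc uW using u01(2) by (auto intro!: AE_I2 max_absorb1)
    qed auto
    then show "AE s in L. w s * y k s \<le> 1"
      by eventually_elim (auto simp: w_def y_def)
  qed
  have mono': "AE s in L. \<forall>k l. q k \<le> q l \<longrightarrow> y k s \<le> y l s"
    unfolding AE_all_countable
  proof (intro allI)
    fix k l
    show "AE s in L. q k \<le> q l \<longrightarrow> y k s \<le> y l s"
    proof (cases "q k \<le> q l")
      case True
      have "AE s in L. max 0 (decode (Suc k) s / a k - decode (Suc l) s / a l) = 0"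
      proof (rule closed[of "\<lambda>v. max 0 (v (Suc k) / a k - v (Suc l) / a l)" "1 / a k"])
        show "continuous_on UNIV (\<lambda>s. max 0 (decode (Suc k) s / a k - decode (Suc l) s / a l))"
          using a_pos[of k] a_pos[of l] by (intro continuous_intros continuous_decode) simp_all
        show "max 0 (decode (Suc k) s / a k - decode (Suc l) s / a l) \<le> 1 / a k" for s
          using yb[of k s] yb[of l s] a_pos[of k] by (auto simp: y_def)
        show "(\<lambda>x. max 0 (V n (Suc k) x / a k - V n (Suc l) x / a l)) \<in> borel_measurable (P n)" for n
          using V by measurable
        show "AE \<omega> in N n. max 0 (V n (Suc k) (\<omega>, True) / a k - V n (Suc l) (\<omega>, True) / a l) = 0" for n
          using Ymono[OF True, of n]
        proof eventually_elim
          case (elim \<omega>)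
          then have "max 0 (Y n (q k) \<omega>) \<le> max 0 (Y n (q l) \<omega>)" by (auto simp: max_def)
          then have "u n k \<omega> \<le> u n l \<omega>" using exp_minus_antimono by (auto simp: u_def)
          then show ?case unfolding V_Suc using W0[of n \<omega>]
            by (intro max_absorb1) (simp add: divide_right_mono)
        qed
      qed auto
      then show ?thesis by eventually_elim (auto simp: y_def)
    qed simp
  qed

  have main: "- ln (\<integral>\<omega>. exp_minus (\<Sum>i<d. ereal (z i) * H (q (\<kappa> i)) \<omega>) \<partial>M) = (\<integral>s. levy_kernel d z (w s) (\<lambda>i. y (\<kappa> i) s) \<partial>L)"
    if z: "\<forall>i<d. 0 \<le> z i" for d :: nat and z and \<kappa> :: "nat \<Rightarrow> nat"
  proof -
    define f where "f v = levy_kernel d z (v 0) (\<lambda>i. v (Suc (\<kappa> i)) / a (\<kappa> i))" for v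
    have z': "0 \<le> z i" if "i < d" for i using z that by simp
    have "\<exists>C. \<forall>w y. (\<forall>i<d. \<bar>y i\<bar> \<le> 1 / a (\<kappa> i)) \<longrightarrow> \<bar>levy_kernel d z w y\<bar> \<le> C"
      by (rule levy_kernel_bounded[OF z'])
    then obtain C where C: "\<forall>w y. (\<forall>i<d. \<bar>y i\<bar> \<le> 1 / a (\<kappa> i)) \<longrightarrow> \<bar>levy_kernel d z w y\<bar> \<le> C"
      by (rule exE)
    have "(\<lambda>n. \<integral>x. f (\<lambda>k. V (r n) k x) \<partial>P (r n)) \<longlonglongrightarrow> (\<integral>s. f (\<lambda>k. decode k s) \<partial>L)"
    proof (rule lim)
      show "continuous_on UNIV (\<lambda>s. f (\<lambda>k. decode k s))"
        unfolding continuous_on_def f_def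
      proof
        fix s
        have "((\<lambda>s. decode (Suc (\<kappa> i)) s / a (\<kappa> i)) \<longlongrightarrow> decode (Suc (\<kappa> i)) s / a (\<kappa> i)) (at s)" for i
          using a_pos[of "\<kappa> i"] by (intro tendsto_divide dec_at tendsto_const) auto
        then show "((\<lambda>s. levy_kernel d z (decode 0 s) (\<lambda>i. decode (Suc (\<kappa> i)) s / a (\<kappa> i)))
            \<longlongrightarrow> levy_kernel d z (decode 0 s) (\<lambda>i. decode (Suc (\<kappa> i)) s / a (\<kappa> i))) (at s)"
          by (intro continuous_levy_kernel dec_at z')
      qed
      show "\<bar>f (\<lambda>k. decode k s)\<bar> \<le> C" for s
        unfolding f_def
      proof (rule C[rule_format])
        show "\<bar>decode (Suc (\<kappa> i)) s / a (\<kappa> i)\<bar> \<le> 1 / a (\<kappa> i)" for i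
          using yb[of "\<kappa> i" s] unfolding y_def by (simp only: abs_of_nonneg)
      qed
    qed
    moreover have "(\<integral>x. f (\<lambda>k. V n k x) \<partial>P n) =
      real (Suc n) * (1 - (\<integral>\<omega>. exp_minus (\<Sum>i<d. ereal (z i) * Y n (q (\<kappa> i)) \<omega>) \<partial>N n))" for n
    proof -
      have "(\<integral>x. f (\<lambda>k. V n k x) \<partial>P n) = (\<integral>\<omega>. g n \<omega> * f (\<lambda>k. V n k (\<omega>, True)) \<partial>N n)"
      proof (rule P_int)
        show "(\<lambda>x. f (\<lambda>k. V n k x)) \<in> borel_measurable (P n)"
          unfolding f_def using V by (intro measurable_levy_kernel) auto
      qed (simp add: V_False f_def levy_kernel_0_right)
      also have "\<dots> = (\<integral>\<omega>. real (Suc n) * (1 - exp_minus (\<Sum>i<d. ereal (z i) * Y n (q (\<kappa> i)) \<omega>)) \<partial>N n)"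
      proof (rule integral_cong_AE)
        show "(\<lambda>\<omega>. g n \<omega> * f (\<lambda>k. V n k (\<omega>, True))) \<in> borel_measurable (N n)"
          unfolding f_def V_0 V_Suc g_def by measurable
        have "AE \<omega> in N n. \<forall>i<d. 0 \<le> Y n (q (\<kappa> i)) \<omega>"
          using Y0 by (simp add: AE_all_countable)
        then show "AE \<omega> in N n. g n \<omega> * f (\<lambda>k. V n k (\<omega>, True)) =
            real (Suc n) * (1 - exp_minus (\<Sum>i<d. ereal (z i) * Y n (q (\<kappa> i)) \<omega>))"
        proof eventually_elim
          case (elim \<omega>)
          \<comment> \<open>The factor \<open>W\<close> of the density cancels the division by
            \<open>w\<close> built into the kernel.\<close>
          have "W n \<omega> * f (\<lambda>k. V n k (\<omega>, True)) = 1 - (\<Prod>i<d. rpow (z i) (1 - u n (\<kappa> i) \<omega>))"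
            unfolding f_def V_0 V_Suc by (subst levy_kernel_mult; simp only: uW) (simp_all add: u01)
          also have "(\<Prod>i<d. rpow (z i) (1 - u n (\<kappa> i) \<omega>)) = exp_minus (\<Sum>i<d. ereal (z i) * Y n (q (\<kappa> i)) \<omega>)"
            using elim z' by (subst exp_minus_weighted_sum) (auto simp: u_def max_def)
          finally show ?case by (simp add: g_def)
        qed
      qed measurable
      also have "\<dots> = real (Suc n) * (1 - (\<integral>\<omega>. exp_minus (\<Sum>i<d. ereal (z i) * Y n (q (\<kappa> i)) \<omega>) \<partial>N n))"
      proof -
        have "AE \<omega> in N n. \<forall>i<d. 0 \<le> Y n (q (\<kappa> i)) \<omega>"
          using Y0 by (simp add: AE_all_countable)
        then have "AE \<omega> in N n. norm (exp_minus (\<Sum>i<d. ereal (z i) * Y n (q (\<kappa> i)) \<omega>)) \<le> 1"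
        proof eventually_elim
          case (elim \<omega>)
          then have "0 \<le> (\<Sum>i<d. ereal (z i) * Y n (q (\<kappa> i)) \<omega>)" using z' by (intro sum_nonneg) auto
          from exp_minus_bounds[OF this] show ?case by simp
        qed
        then have "integrable (N n) (\<lambda>\<omega>. exp_minus (\<Sum>i<d. ereal (z i) * Y n (q (\<kappa> i)) \<omega>))"
          by (rule N.integrable_const_bound) measurable
        then show ?thesis by (simp add: N.prob_space)
      qed
      finally show ?thesis .
    qed
    moreover have "(\<lambda>n. real (Suc n) * (1 - (\<integral>\<omega>. exp_minus (\<Sum>i<d. ereal (z i) * Y n (q (\<kappa> i)) \<omega>) \<partial>N n)))
        \<longlonglongrightarrow> - ln (\<integral>\<omega>. exp_minus (\<Sum>i<d. ereal (z i) * H (q (\<kappa> i)) \<omega>) \<partial>M)"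
    proof (rule root_limit)
      show "0 < (\<integral>\<omega>. exp_minus (\<Sum>i<d. ereal (z i) * H (q (\<kappa> i)) \<omega>) \<partial>M)" using pos[OF z] .
      show "(\<integral>\<omega>. exp_minus (\<Sum>i<d. ereal (z i) * Y n (q (\<kappa> i)) \<omega>) \<partial>N n) ^ Suc n =
          (\<integral>\<omega>. exp_minus (\<Sum>i<d. ereal (z i) * H (q (\<kappa> i)) \<omega>) \<partial>M)" for n
        using root[OF z] by simp
      show "0 \<le> (\<integral>\<omega>. exp_minus (\<Sum>i<d. ereal (z i) * Y n (q (\<kappa> i)) \<omega>) \<partial>N n)" for n
      proof (rule integral_nonneg_AE)
        have "AE \<omega> in N n. \<forall>i<d. 0 \<le> Y n (q (\<kappa> i)) \<omega>"
          using Y0 by (simp add: AE_all_countable)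
        then show "AE \<omega> in N n. 0 \<le> exp_minus (\<Sum>i<d. ereal (z i) * Y n (q (\<kappa> i)) \<omega>)"
          by eventually_elim (use z' in \<open>auto intro!: exp_minus_bounds sum_nonneg\<close>)
      qed
    qed
    ultimately have "(\<integral>s. f (\<lambda>k. decode k s) \<partial>L) = - ln (\<integral>\<omega>. exp_minus (\<Sum>i<d. ereal (z i) * H (q (\<kappa> i)) \<omega>) \<partial>M)"
      by (intro LIMSEQ_unique[OF _ LIMSEQ_subseq_LIMSEQ[OF _ r, unfolded comp_def]]) simp_all
    then show ?thesis by (simp add: f_def w_def y_def)
  qed
  show ?thesis
  proof (rule that[of L w y "\<lambda>k. 1 / a k"])
    show "w \<in> borel_measurable L" unfolding w_def by measurable
    show "\<forall>k. y k \<in> borel_measurable L" unfolding y_def[abs_def] by measurable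
  qed (use le1 mono' main wb yb L.prob_space_axioms in auto)
qed

section \<open>The limit paths\<close>

lemma mono_has_left_limit:
  fixes x :: "real \<Rightarrow> 'b :: {conditionally_complete_linorder, linorder_topology}"
  assumes "mono x"
  shows "\<exists>l. (x \<longlongrightarrow> l) (at_left t)"
proof
  have bdd: "bdd_above (x ` {..<t})"
    by (intro bdd_aboveI[of _ "x t"]) (auto intro!: monoD[OF assms])
  have ne: "{..<t} \<noteq> {}" using lt_ex[of t] by auto
  show "(x \<longlongrightarrow> (SUP s\<in>{..<t}. x s)) (at_left t)"
  proof (rule order_tendstoI)
    fix a assume "a < (SUP s\<in>{..<t}. x s)"
    then obtain s where s: "s < t" "a < x s" using less_cSUP_iff[OF ne bdd] by auto
    then have "\<forall>\<^sub>F r in at_left t. s < r" by (auto simp: eventually_at_left_field)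
    then show "\<forall>\<^sub>F r in at_left t. a < x r"
      by eventually_elim (auto intro!: less_le_trans[OF s(2)] monoD[OF assms])
  next
    fix a assume a: "(SUP s\<in>{..<t}. x s) < a"
    have "\<forall>\<^sub>F r in at_left t. r < t" by (auto simp: eventually_at_filter)
    then show "\<forall>\<^sub>F r in at_left t. x r < a"
      by eventually_elim (use a in \<open>auto intro: le_less_trans[OF cSUP_upper[OF _ bdd]]\<close>)
  qed
qed

lemma mono_cadlagI:
  fixes x :: "real \<Rightarrow> 'b :: {conditionally_complete_linorder, linorder_topology}"
  assumes "mono x" "\<And>t. (x \<longlongrightarrow> x t) (at_right t)"
  shows "cadlag x"
  using assms mono_has_left_limit by (auto simp: cadlag_def)

lemma mono_tendsto_at_bot:
  fixes x :: "real \<Rightarrow> 'b :: linorder_topology"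
  assumes "mono x" "\<And>t. l \<le> x t" "(\<lambda>n. x (- real n)) \<longlonglongrightarrow> l"
  shows "(x \<longlongrightarrow> l) at_bot"
proof (rule order_tendstoI)
  fix a assume "a < l"
  then show "\<forall>\<^sub>F t in at_bot. a < x t" by (intro always_eventually allI less_le_trans[OF _ assms(2)])
next
  fix a assume "l < a"
  from order_tendstoD(2)[OF assms(3) this] obtain n where n: "x (- real n) < a"
    by (auto simp: eventually_sequentially)
  have "\<forall>\<^sub>F t in at_bot. t \<le> - real n" by (rule eventually_le_at_bot)
  then show "\<forall>\<^sub>F t in at_bot. x t < a"
    by eventually_elim (use n in \<open>auto intro: le_less_trans monoD[OF assms(1)]\<close>)
qed

lemma real_seq_at_bot: "filterlim (\<lambda>n. - real n) at_bot sequentially"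
  by (simp add: filterlim_uminus_at_bot filterlim_real_sequentially)

lemma M0_inf_nonneg:
  assumes "x \<in> M0_inf"
  shows "0 \<le> x t"
proof -
  have mono: "mono x" using assms by (simp add: M0_inf_def)
  have "\<forall>\<^sub>F s in at_bot. x s \<le> x t"
    using eventually_le_at_bot[of t] by eventually_elim (rule monoD[OF mono])
  then show ?thesis
    using assms by (intro tendsto_upperbound[of x 0 at_bot]) (auto simp: M0_inf_def)
qed

section \<open>Measurability of the path space and of the zero path\<close>

lemma space_D_inf_algebra: "space D_inf_algebra = D_inf"
  by (simp add: D_inf_algebra_def space_restrict_space space_PiM)

lemma measurable_D_inf_coordinate: "(\<lambda>x. x t) \<in> borel_measurable D_inf_algebra"
  unfolding D_inf_algebra_def
  by (rule measurable_restrict_space1) (rule measurable_component_singleton, simp)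

text \<open>Right continuity reduces monotonicity to countably many comparisons, which makes it a
  measurable condition.\<close>

lemma mono_D_inf_iff:
  fixes q :: "nat \<Rightarrow> real"
  assumes x: "x \<in> D_inf" and dense: "\<And>a b :: real. a < b \<Longrightarrow> \<exists>k. a < q k \<and> q k < b"
  shows "mono x \<longleftrightarrow> (\<forall>k l. q k \<le> q l \<longrightarrow> x (q k) \<le> x (q l))"
proof
  assume r: "\<forall>k l. q k \<le> q l \<longrightarrow> x (q k) \<le> x (q l)"
  have rc: "(x \<longlongrightarrow> x t) (at_right t)" for t using x by (simp add: D_inf_def cadlag_def)
  show "mono x"
  proof (rule monoI)
    fix s t :: real assume "s \<le> t"
    show "x s \<le> x t"
    proof (cases "s = t")
      case False
      with \<open>s \<le> t\<close> have "s < t" by simp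
      \<comment> \<open>The left argument is approximated first, by points of the sequence just
        above \<open>s\<close>; the right one afterwards, by points just above
        \<open>t\<close>.\<close>
      have 1: "x s \<le> x (q l)" if "s < q l" for l
      proof (rule ccontr)
        assume "\<not> x s \<le> x (q l)"
        then have "\<forall>\<^sub>F r in at_right s. x (q l) < x r" using rc[of s] by (intro order_tendstoD) auto
        then obtain b where b: "s < b" "\<And>r. s < r \<Longrightarrow> r < b \<Longrightarrow> x (q l) < x r"
          by (auto simp: eventually_at_right_field)
        have "s < min b (q l)" using b that by simp
        from dense[OF this] obtain k where "s < q k" "q k < min b (q l)" by blast
        then show False using r[rule_format, of k l] b(2)[of "q k"] by (auto dest: leD)
      qed
      show ?thesis
      proof (rule ccontr)
        assume "\<not> x s \<le> x t"
        then have "\<forall>\<^sub>F r in at_right t. x r < x s" using rc[of t] by (intro order_tendstoD) auto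
        then obtain b where b: "t < b" "\<And>r. t < r \<Longrightarrow> r < b \<Longrightarrow> x r < x s"
          by (auto simp: eventually_at_right_field)
        obtain k where "t < q k" "q k < b" using dense[of t b] b by auto
        then show False using 1[of k] b(2)[of "q k"] \<open>s < t\<close> by (auto dest: leD)
      qed
    qed simp
  qed
qed (auto intro: monoD[of x])

lemma M0_inf_iff:
  assumes "mono x" "x \<in> D_inf"
  shows "x \<in> M0_inf \<longleftrightarrow> (INF n. x (- real n)) = 0"
proof -
  have "decseq (\<lambda>n. x (- real n))" using assms by (auto simp: decseq_def intro!: monoD[of x])
  then have lim: "(\<lambda>n. x (- real n)) \<longlonglongrightarrow> (INF n. x (- real n))" by (rule LIMSEQ_INF)
  show ?thesis
  proof
    assume "x \<in> M0_inf"
    then have "(x \<longlongrightarrow> 0) at_bot" by (simp add: M0_inf_def)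
    from filterlim_compose[OF this real_seq_at_bot] show "(INF n. x (- real n)) = 0"
      using lim by (blast intro: LIMSEQ_unique)
  next
    assume 0: "(INF n. x (- real n)) = 0"
    have "0 \<le> x t" for t
    proof -
      obtain n where "- t \<le> real n" using real_arch_simple[of "- t"] by blast
      then have "x (- real n) \<le> x t" by (intro monoD[OF assms(1)]) simp
      moreover have "0 \<le> x (- real n)" using INF_lower[of n UNIV "\<lambda>n. x (- real n)"] 0 by simp
      ultimately show ?thesis by simp
    qed
    then have "(x \<longlongrightarrow> 0) at_bot" using assms(1) lim 0 by (intro mono_tendsto_at_bot) auto
    then show "x \<in> M0_inf" using assms by (simp add: M0_inf_def)
  qed
qed

lemma dense_sequence_exists:
  obtains q :: "nat \<Rightarrow> real" where "\<And>a b. a < b \<Longrightarrow> \<exists>k. a < q k \<and> q k < b"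
proof -
  have "range (from_nat_into (\<rat> :: real set)) = \<rat>"
    by (rule range_from_nat_into) (auto simp: countable_rat)
  then have "\<exists>k. a < from_nat_into \<rat> k \<and> from_nat_into \<rat> k < b" if "a < b" for a b :: real
    using Rats_dense_in_real[OF that] by (metis image_iff)
  then show ?thesis by (rule that)
qed

lemma sets_M0_inf: "M0_inf \<in> sets D_inf_algebra"
proof -
  obtain q :: "nat \<Rightarrow> real" where q: "\<And>a b. a < b \<Longrightarrow> \<exists>k. a < q k \<and> q k < b"
    by (rule dense_sequence_exists) blast
  have "M0_inf = {x \<in> space D_inf_algebra. (\<forall>k l. q k \<le> q l \<longrightarrow> x (q k) \<le> x (q l)) \<and> (INF n. x (- real n)) = 0}"
  proof (rule set_eqI)
    fix x
    have "x \<in> M0_inf \<longleftrightarrow> x \<in> D_inf \<and> mono x \<and> (INF n. x (- real n)) = 0"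
    proof -
      have "x \<in> M0_inf \<Longrightarrow> x \<in> D_inf \<and> mono x" by (simp add: M0_inf_def)
      then show ?thesis using M0_inf_iff[of x] by blast
    qed
    then show "x \<in> M0_inf \<longleftrightarrow> x \<in> {x \<in> space D_inf_algebra.
        (\<forall>k l. q k \<le> q l \<longrightarrow> x (q k) \<le> x (q l)) \<and> (INF n. x (- real n)) = 0}"
      by (cases "x \<in> D_inf") (simp_all add: space_D_inf_algebra mono_D_inf_iff[OF _ q])
  qed
  also have "\<dots> \<in> sets D_inf_algebra"
    by (intro sets.sets_Collect_conj sets.sets_Collect_countable_All sets.sets_Collect_imp
        sets.sets_Collect_const borel_measurable_le borel_measurable_eq borel_measurable_INF
        borel_measurable_const measurable_D_inf_coordinate countableI_type)
  finally show ?thesis .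
qed

text \<open>Singletons are not measurable in the full uncountable product. They become so on the
  trace, because a right-continuous path is determined by its values on a dense sequence.\<close>

lemma sets_zero_path: "{\<lambda>_. 0} \<in> sets D_inf_algebra"
proof -
  obtain q :: "nat \<Rightarrow> real" where q: "\<And>a b. a < b \<Longrightarrow> \<exists>k. a < q k \<and> q k < b"
    by (rule dense_sequence_exists) blast
  have zero: "(\<lambda>_. 0) \<in> D_inf" by (auto simp: D_inf_def cadlag_def)
  have "x = (\<lambda>_. 0)" if x: "x \<in> D_inf" and z: "\<And>k. x (q k) = 0" for x
  proof
    fix t
    show "x t = 0"
    proof (rule ccontr)
      assume "x t \<noteq> 0"
      moreover have "(x \<longlongrightarrow> x t) (at_right t)" using x by (simp add: D_inf_def cadlag_def)
      ultimately have "\<forall>\<^sub>F r in at_right t. x r \<noteq> 0" using tendsto_imp_eventually_ne by blast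
      then obtain b where b: "t < b" "\<And>r. t < r \<Longrightarrow> r < b \<Longrightarrow> x r \<noteq> 0"
        by (auto simp: eventually_at_right_field)
      then show False using q[of t b] z by blast
    qed
  qed
  then have "{\<lambda>_. 0} = {x \<in> space D_inf_algebra. \<forall>k. x (q k) = 0}"
    using zero unfolding space_D_inf_algebra by blast
  also have "\<dots> \<in> sets D_inf_algebra"
    by (intro sets.sets_Collect_countable_All borel_measurable_eq borel_measurable_const
        measurable_D_inf_coordinate)
  finally show ?thesis .
qed

text \<open>Follows from \<open>exp (- r) \<le> 1 / (1 + r)\<close> and
  \<open>min r 1 \<le> 2 * r / (1 + r)\<close>; this is the origin of the constant 2. It converts
  integrability of \<open>min x 1\<close> into a bound on slopes.\<close>

lemma min_le_exp_minus:
  assumes "0 \<le> x"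
  shows "min x 1 \<le> ereal (2 * (1 - exp_minus x))"
proof (cases x)
  case (real r)
  have "1 + r \<le> exp r" by (rule exp_ge_add_one_self)
  then have "exp (- r) \<le> inverse (1 + r)"
    using assms real by (simp add: exp_minus) 
  moreover have "min r 1 \<le> 2 * (1 - inverse (1 + r))"
  proof -
    have "2 * (1 - inverse (1 + r)) = 2 * r / (1 + r)" using assms real by (simp add: field_simps)
    moreover have "min r 1 * (1 + r) \<le> 2 * r"
      using assms real mult_left_mono[of r 1 r] by (auto simp: min_def algebra_simps)
    ultimately show ?thesis using assms real by (simp add: pos_le_divide_eq)
  qed
  moreover have "2 * (1 - inverse (1 + r)) \<le> 2 * (1 - exp (- r))"
    using calculation(1) by (intro mult_left_mono) auto
  ultimately have "min r 1 \<le> 2 * (1 - exp (- r))" by (blast intro: order_trans)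
  then show ?thesis using real by (simp add: min_def split: if_splits)
qed (use assms in auto)

text \<open>The outcome of the compactness argument, detached from \<open>H\<close>: the Levy
  measure and the drift are built from these data alone.\<close>

locale levy_limit = prob_space L for L :: "'b measure" +
  fixes w :: "'b \<Rightarrow> real" and y :: "nat \<Rightarrow> 'b \<Rightarrow> real" and B q :: "nat \<Rightarrow> real"
  assumes w_measurable [measurable]: "w \<in> borel_measurable L"
    and y_measurable [measurable]: "\<And>k. y k \<in> borel_measurable L"
    and w_nonneg: "\<And>s. 0 \<le> w s"
    and y_nonneg: "\<And>k s. 0 \<le> y k s" and y_le: "\<And>k s. y k s \<le> B k"
    and w_y_le: "AE s in L. \<forall>k. w s * y k s \<le> 1"
    and y_mono: "AE s in L. \<forall>k l. q k \<le> q l \<longrightarrow> y k s \<le> y l s"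
    and q_dense: "\<And>a b. a < b \<Longrightarrow> \<exists>k. a < q k \<and> q k < b"
begin

text \<open>In the limit, the paths with positive weight \<open>w\<close> carry the Levy measure, while the mass that
  collapses to \<open>w = 0\<close> retains its shape \<open>y\<close> and produces the drift.\<close>

definition slope :: "real \<Rightarrow> 'b \<Rightarrow> real" where
  "slope t s = (INF k\<in>{k. t < q k}. y k s)"

text \<open>The points where the rebuilt path is meaningful: its coordinates stay within the range
  of \<open>1 - exp_minus\<close>, and it tends to 0 at minus infinity. Elsewhere
  \<open>jump_path\<close> is set to the zero path, so that it takes values in \<open>M0_inf\<close>
  without exception.\<close>

definition regular :: "'b \<Rightarrow> bool" where
  "regular s \<longleftrightarrow> 0 < w s \<and> (\<forall>k. w s * y k s \<le> 1) \<and> (INF n. slope (- real n) s) = 0"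

definition jump_path :: "'b \<Rightarrow> real \<Rightarrow> ereal" where
  "jump_path s = (if regular s then (\<lambda>t. log_ext (w s * slope t s)) else (\<lambda>_. 0))"

definition drift :: "real \<Rightarrow> real" where
  "drift t = (\<integral>s. indicator {s. w s = 0} s * slope t s \<partial>L)"

text \<open>The density \<open>1 / w\<close> undoes the weighting. Zero paths get weight 0, which
  ensures that the zero path is a null set; a non-zero path comes from a regular point, where
  \<open>w\<close> is positive.\<close>

definition levy :: "(real \<Rightarrow> ereal) measure" where
  "levy = distr (density L (\<lambda>s. ennreal (if jump_path s = (\<lambda>_. 0) then 0 else 1 / w s))) D_inf_algebra jump_path"

lemma slope_index: "\<exists>k. t < q k"
  using q_dense[of t "t + 1"] by auto

lemma slope_bdd: "bdd_below ((\<lambda>k. y k s) ` K)"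
  using y_nonneg by (intro bdd_belowI[of _ 0]) auto

lemma slope_nonneg: "0 \<le> slope t s"
  unfolding slope_def using slope_index[of t] y_nonneg by (intro cINF_greatest) auto

lemma slope_le: "t < q k \<Longrightarrow> slope t s \<le> y k s"
  unfolding slope_def by (intro cINF_lower slope_bdd) auto

lemma slope_bounded: "\<exists>C. \<forall>s. slope t s \<le> C"
proof -
  obtain k where "t < q k" using slope_index by blast
  then have "slope t s \<le> B k" for s using slope_le[of t k s] y_le[of k s] by linarith
  then show ?thesis by blast
qed

lemma slope_mono: "t \<le> t' \<Longrightarrow> slope t s \<le> slope t' s"
  unfolding slope_def using slope_index[of t'] by (intro cINF_superset_mono slope_bdd) auto

lemma slope_measurable [measurable]: "slope t \<in> borel_measurable L"
  unfolding slope_def[abs_def] by (intro borel_measurable_cINF slope_bdd) auto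

lemma slope_integrable: "integrable L (slope t)"
proof -
  obtain C where "\<forall>s. slope t s \<le> C" using slope_bounded by blast
  then show ?thesis using slope_nonneg by (intro integrable_const_bound[of _ C]) auto
qed

lemma slope_less: "slope t s < a \<Longrightarrow> \<exists>k. t < q k \<and> y k s < a"
  unfolding slope_def using slope_index[of t] by (subst (asm) cINF_less_iff[OF _ slope_bdd]) auto

text \<open>An index \<open>k\<close> with \<open>t < q k\<close> that nearly attains the infimum at
  \<open>t\<close> is admissible for every time before \<open>q k\<close>; the strict inequality in
  \<open>slope\<close> is essential.\<close>

lemma slope_right_continuous: "((\<lambda>t. slope t s) \<longlongrightarrow> slope t s) (at_right t)"
proof (rule order_tendstoI)
  fix a assume a: "a < slope t s"
  have "\<forall>\<^sub>F r in at_right t. t < r" by (auto simp: eventually_at_filter)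
  then show "\<forall>\<^sub>F r in at_right t. a < slope r s"
    by eventually_elim (intro less_le_trans[OF a] slope_mono less_imp_le)
next
  fix a assume "slope t s < a"
  then obtain k where k: "t < q k" "y k s < a" using slope_less by blast
  then have "\<forall>\<^sub>F r in at_right t. r < q k" by (auto simp: eventually_at_right_field)
  then show "\<forall>\<^sub>F r in at_right t. slope r s < a"
    by eventually_elim (intro le_less_trans[OF _ k(2)] slope_le)
qed

text \<open>For any \<open>k\<close> with \<open>t < q k\<close>, the times
  \<open>q (\<kappa> m)\<close> eventually drop below \<open>q k\<close>; monotonicity then traps
  the values between \<open>slope t s\<close> and \<open>y k s\<close>.\<close>

lemma slope_limit:
  assumes "\<forall>k l. q k \<le> q l \<longrightarrow> y k s \<le> y l s" and \<kappa>: "\<And>m. t < q (\<kappa> m)" "(\<lambda>m. q (\<kappa> m)) \<longlonglongrightarrow> t"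
  shows "(\<lambda>m. y (\<kappa> m) s) \<longlonglongrightarrow> slope t s"
proof (rule order_tendstoI)
  fix a assume "a < slope t s"
  then show "\<forall>\<^sub>F m in sequentially. a < y (\<kappa> m) s"
    by (intro always_eventually allI less_le_trans[OF _ slope_le[OF \<kappa>(1)]])
next
  fix a assume "slope t s < a"
  then obtain k where k: "t < q k" "y k s < a" using slope_less by blast
  from order_tendstoD(2)[OF \<kappa>(2) k(1)] show "\<forall>\<^sub>F m in sequentially. y (\<kappa> m) s < a"
  proof eventually_elim
    case (elim m)
    then have "y (\<kappa> m) s \<le> y k s" using assms(1)[rule_format, of "\<kappa> m" k] by simp
    then show ?case using k(2) by simp
  qed
qed

lemma w_slope_le:
  assumes "0 < w s" "\<forall>k. w s * y k s \<le> 1"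
  shows "w s * slope t s \<le> 1"
proof -
  obtain k where "t < q k" using slope_index by blast
  then have "w s * slope t s \<le> w s * y k s" using assms slope_le by (intro mult_left_mono) auto
  also have "\<dots> \<le> 1" using assms(2) by blast
  finally show ?thesis .
qed

lemma slope_seq_bdd: "bdd_below (range (\<lambda>n. slope (- real n) s))"
  by (intro bdd_belowI[of _ 0]) (auto simp: slope_nonneg)

lemma slope_INF_measurable [measurable]: "(\<lambda>s. INF n. slope (- real n) s) \<in> borel_measurable L"
  by (rule borel_measurable_cINF[OF _ slope_measurable slope_seq_bdd]) simp

lemma slope_INF_limit: "(\<lambda>n. slope (- real n) s) \<longlonglongrightarrow> (INF n. slope (- real n) s)"
  by (intro LIMSEQ_decseq_INF slope_seq_bdd) (auto simp: decseq_def intro!: slope_mono)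

lemma jump_path_M0_inf: "jump_path s \<in> M0_inf"
proof (cases "regular s")
  case True
  have mono: "mono (jump_path s)"
    using True w_nonneg slope_mono by (auto simp: jump_path_def intro!: monoI log_ext_mono mult_left_mono)
  have "(jump_path s \<longlongrightarrow> jump_path s t) (at_right t)" for t
    using True by (auto simp: jump_path_def intro!: log_ext_tendsto tendsto_mult tendsto_const slope_right_continuous)
  then have D: "jump_path s \<in> D_inf" using mono mono_cadlagI by (auto simp: D_inf_def)
  have "(\<lambda>n. w s * slope (- real n) s) \<longlonglongrightarrow> w s * 0"
    using slope_INF_limit[of s] True by (intro tendsto_intros) (auto simp: regular_def)
  then have "(\<lambda>n. jump_path s (- real n)) \<longlonglongrightarrow> 0"
    using True log_ext_tendsto[of "\<lambda>n. w s * slope (- real n) s" 0] by (simp add: jump_path_def)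
  moreover have "0 \<le> jump_path s t" for t
    using True w_nonneg[of s] slope_nonneg[of t s] by (simp add: jump_path_def log_ext_nonneg)
  ultimately have "(jump_path s \<longlongrightarrow> 0) at_bot"
    by (intro mono_tendsto_at_bot[OF mono])
  then show ?thesis using D mono by (simp add: M0_inf_def)
qed (auto simp: jump_path_def M0_inf_def D_inf_def cadlag_def mono_def)

lemma regular_measurable [measurable]: "Measurable.pred L regular"
  unfolding regular_def by measurable

lemma jump_path_coordinate_measurable [measurable]: "(\<lambda>s. jump_path s t) \<in> borel_measurable L"
proof -
  have "(\<lambda>s. if regular s then log_ext (w s * slope t s) else 0) \<in> borel_measurable L" by measurable
  then show ?thesis by (rule measurable_cong[THEN iffD1, rotated]) (simp add: jump_path_def)
qed

lemma jump_path_measurable [measurable]: "jump_path \<in> measurable L D_inf_algebra"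
  unfolding D_inf_algebra_def
proof (rule measurable_restrict_space2)
  show "jump_path \<in> space L \<rightarrow> D_inf" using jump_path_M0_inf by (auto simp: M0_inf_def)
  show "jump_path \<in> measurable L (Pi\<^sub>M UNIV (\<lambda>_. borel))"
    by (rule measurable_PiM_single') auto
qed

lemma jump_path_zero_measurable [measurable]: "Measurable.pred L (\<lambda>s. jump_path s = (\<lambda>_. 0))"
  using measurable_sets[OF jump_path_measurable sets_zero_path]
  by (simp add: pred_def vimage_def Int_def conj_commute)

lemma exp_minus_path: "regular s \<Longrightarrow> exp_minus (jump_path s t) = 1 - w s * slope t s"
  using w_slope_le by (simp add: jump_path_def regular_def exp_minus_log_ext)

lemma levy_measure_levy: "levy_measure_on_M0_inf levy"
  unfolding levy_measure_on_M0_inf_def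
proof (intro conjI allI)
  show "sets levy = sets D_inf_algebra" by (simp add: levy_def)
  show "AE x in levy. x \<in> M0_inf"
    unfolding levy_def using jump_path_M0_inf sets_M0_inf
    by (subst AE_distr_iff) (auto simp: M0_inf_def space_D_inf_algebra Collect_conj_eq Int_absorb1)
  show "{\<lambda>_. 0} \<in> null_sets levy"
  proof
    show "{\<lambda>_. 0} \<in> sets levy" using sets_zero_path by (simp add: levy_def)
    have "emeasure levy {\<lambda>_. 0} = emeasure (density L (\<lambda>s. ennreal (if jump_path s = (\<lambda>_. 0) then 0 else 1 / w s))) {s \<in> space L. jump_path s = (\<lambda>_. 0)}"
      unfolding levy_def using sets_zero_path
      by (subst emeasure_distr) (auto intro!: arg_cong2[where f = emeasure])
    also have "\<dots> = (\<integral>\<^sup>+ s. ennreal (if jump_path s = (\<lambda>_. 0) then 0 else 1 / w s) *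
        indicator {s \<in> space L. jump_path s = (\<lambda>_. 0)} s \<partial>L)"
      by (rule emeasure_density) auto
    also have "\<dots> = (\<integral>\<^sup>+ s. 0 \<partial>L)"
      by (rule nn_integral_cong) (simp add: indicator_def)
    finally show "emeasure levy {\<lambda>_. 0} = 0" by simp
  qed
  fix t
  obtain C where C: "\<forall>s. slope t s \<le> C" using slope_bounded by blast
  have "(\<integral>\<^sup>+ x. e2ennreal (min (x t) 1) \<partial>levy) =
      (\<integral>\<^sup>+ s. ennreal (if jump_path s = (\<lambda>_. 0) then 0 else 1 / w s) * e2ennreal (min (jump_path s t) 1) \<partial>L)"
  proof -
    have [measurable]: "(\<lambda>x. e2ennreal (min (x t) 1)) \<in> borel_measurable D_inf_algebra"
      by (intro measurable_compose[OF _ measurable_e2ennreal] borel_measurable_min borel_measurable_const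
          measurable_D_inf_coordinate)
    show ?thesis
      unfolding levy_def by (subst nn_integral_distr) (auto simp: nn_integral_density)
  qed
  \<comment> \<open>On regular points \<open>1 - exp_minus (jump_path s t)\<close> equals
    \<open>w s * slope t s\<close>, so the density \<open>1 / w s\<close> leaves at most twice the
    slope.\<close>
  also have "\<dots> \<le> (\<integral>\<^sup>+ s. ennreal (2 * C) \<partial>L)"
  proof (rule nn_integral_mono)
    fix s
    show "ennreal (if jump_path s = (\<lambda>_. 0) then 0 else 1 / w s) * e2ennreal (min (jump_path s t) 1) \<le> ennreal (2 * C)"
    proof (cases "jump_path s = (\<lambda>_. 0)")
      case False
      then have r: "regular s" by (auto simp: jump_path_def)
      then have w: "0 < w s" by (simp add: regular_def)
      have "min (jump_path s t) 1 \<le> ereal (2 * (w s * slope t s))"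
        using min_le_exp_minus[OF M0_inf_nonneg[OF jump_path_M0_inf], of s t] exp_minus_path[OF r, of t] by simp
      then have "e2ennreal (min (jump_path s t) 1) \<le> ennreal (2 * (w s * slope t s))"
        unfolding ennreal.abs_eq[symmetric] e2ennreal_ereal[symmetric] by (rule e2ennreal_mono)
      then have "ennreal (1 / w s) * e2ennreal (min (jump_path s t) 1) \<le> ennreal (1 / w s) * ennreal (2 * (w s * slope t s))"
        by (rule mult_left_mono) simp
      also have "\<dots> = ennreal (2 * slope t s)" using w slope_nonneg by (simp flip: ennreal_mult)
      also have "\<dots> \<le> ennreal (2 * C)" using C by (intro ennreal_leI) auto
      finally show ?thesis using False by simp
    qed simp
  qed
  also have "\<dots> < \<infinity>" by (simp add: emeasure_space_1)
  finally show "(\<integral>\<^sup>+ x. e2ennreal (min (x t) 1) \<partial>levy) < \<infinity>" .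
qed

section \<open>The drift\<close>

lemma drift_integrable: "integrable L (\<lambda>s. indicator {s. w s = 0} s * slope t s)"
proof (rule Bochner_Integration.integrable_bound[OF slope_integrable[of t]])
  show "(\<lambda>s. indicator {s. w s = 0} s * slope t s) \<in> borel_measurable L"
    by measurable
qed (auto simp: indicator_def)

lemma drift_mono: "mono drift"
  unfolding drift_def using slope_mono
  by (intro monoI integral_mono drift_integrable) (auto simp: indicator_def)

lemma drift_nonneg: "0 \<le> drift t"
  unfolding drift_def using slope_nonneg by (intro integral_nonneg_AE) auto

lemma drift_right_continuous: "(drift \<longlongrightarrow> drift t) (at_right t)"
proof (rule tendsto_at_right_sequentially[of t "t + 1"])
  fix S assume S: "\<And>n. t < S n" "\<And>n. S n < t + 1" "S \<longlonglongrightarrow> t"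
  have "filterlim S (at_right t) sequentially"
    using S by (auto simp: filterlim_at intro!: always_eventually)
  then have lim: "(\<lambda>n. slope (S n) s) \<longlonglongrightarrow> slope t s" for s
    by (rule filterlim_compose[OF slope_right_continuous])
  show "(\<lambda>n. drift (S n)) \<longlonglongrightarrow> drift t"
    unfolding drift_def
  proof (rule integral_dominated_convergence[where w = "slope (t + 1)"])
    show "AE s in L. (\<lambda>n. indicator {s. w s = 0} s * slope (S n) s) \<longlonglongrightarrow> indicator {s. w s = 0} s * slope t s"
      using lim by (auto intro!: AE_I2 tendsto_mult)
    show "AE s in L. norm (indicator {s. w s = 0} s * slope (S n) s) \<le> slope (t + 1) s" for n
      using slope_mono[of "S n" "t + 1"] S(2)[of n] slope_nonneg
      by (auto intro!: AE_I2 simp: indicator_def)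
  qed (use drift_integrable slope_integrable in auto)
qed simp

lemma drift_properties:
  assumes "(\<lambda>n. \<integral>s. slope (- real n) s \<partial>L) \<longlonglongrightarrow> 0"
  shows "drift \<in> D_real" "(\<lambda>t. ereal (drift t)) \<in> M0_inf"
proof -
  show "drift \<in> D_real"
    using mono_cadlagI[OF drift_mono drift_right_continuous] by (simp add: D_real_def)
  have mono: "mono (\<lambda>t. ereal (drift t))" using drift_mono by (auto simp: mono_def)
  have "cadlag (\<lambda>t. ereal (drift t))"
    by (rule mono_cadlagI[OF mono]) (auto intro: drift_right_continuous)
  moreover have "(\<lambda>n. drift (- real n)) \<longlonglongrightarrow> 0"
  proof (rule tendsto_sandwich[OF _ _ tendsto_const assms])
    show "\<forall>\<^sub>F n in sequentially. drift (- real n) \<le> (\<integral>s. slope (- real n) s \<partial>L)"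
      unfolding drift_def using slope_nonneg
      by (intro always_eventually allI integral_mono drift_integrable slope_integrable) (auto simp: indicator_def)
  qed (simp add: drift_nonneg)
  then have "(drift \<longlongrightarrow> 0) at_bot"
    using drift_mono drift_nonneg by (intro mono_tendsto_at_bot) auto
  then have "((\<lambda>t. ereal (drift t)) \<longlongrightarrow> 0) at_bot"
    by (simp add: zero_ereal_def)
  ultimately show "(\<lambda>t. ereal (drift t)) \<in> M0_inf"
    using mono by (simp add: M0_inf_def D_inf_def)
qed

text \<open>The infimum is non-negative and its mean is at most every mean slope, hence 0. So almost
  every point of positive weight is regular, and no mass is lost by sending the other points to the
  zero path.\<close>

lemma AE_slope_INF:
  assumes "(\<lambda>n. \<integral>s. slope (- real n) s \<partial>L) \<longlonglongrightarrow> 0"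
  shows "AE s in L. (INF n. slope (- real n) s) = 0"
proof -
  let ?l = "\<lambda>s. INF n. slope (- real n) s"
  have l0: "0 \<le> ?l s" for s using slope_nonneg by (intro cINF_greatest) auto
  have ll: "?l s \<le> slope (- real n) s" for n s by (intro cINF_lower slope_seq_bdd) auto
  have int: "integrable L ?l"
  proof (rule Bochner_Integration.integrable_bound[OF slope_integrable[of "- real 0"]])
    show "AE s in L. norm (?l s) \<le> norm (slope (- real 0) s)"
      using l0 ll[of _ 0] slope_nonneg by simp
  qed measurable
  have "(\<integral>s. ?l s \<partial>L) \<le> 0"
    by (rule tendsto_lowerbound[OF assms])
      (auto intro!: always_eventually integral_mono int slope_integrable ll)
  moreover have "0 \<le> (\<integral>s. ?l s \<partial>L)" using l0 by (intro integral_nonneg_AE) auto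
  ultimately show ?thesis using integral_nonneg_eq_0_iff_AE[OF int] l0 by auto
qed

lemma levy_kernel_integral_split:
  assumes vanish: "(\<lambda>n. \<integral>s. slope (- real n) s \<partial>L) \<longlonglongrightarrow> 0" and z: "\<And>i. i < d \<Longrightarrow> 0 \<le> z i"
  shows "(\<integral>s. levy_kernel d z (w s) (\<lambda>i. slope (t i) s) \<partial>L) =
    (\<Sum>i<d. z i * drift (t i)) + (\<integral>x\<in>M0_inf. (1 - exp_minus (\<Sum>i<d. ereal (z i) * x (t i))) \<partial>levy)"
proof -
  let ?k = "\<lambda>s. levy_kernel d z (w s) (\<lambda>i. slope (t i) s)"
  have "\<forall>i. \<exists>C. \<forall>s. slope (t i) s \<le> C" using slope_bounded by blast
  from choice[OF this] obtain C where C: "\<And>i s. slope (t i) s \<le> C i" by blast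
  have "\<exists>D. \<forall>w y. (\<forall>i<d. \<bar>y i\<bar> \<le> C i) \<longrightarrow> \<bar>levy_kernel d z w y\<bar> \<le> D"
    by (rule levy_kernel_bounded[OF z])
  then obtain D where D: "\<forall>w y. (\<forall>i<d. \<bar>y i\<bar> \<le> C i) \<longrightarrow> \<bar>levy_kernel d z w y\<bar> \<le> D"
    by (rule exE)
  have km: "?k \<in> borel_measurable L" by measurable
  have kb: "norm (?k s) \<le> D" for s
    using D C slope_nonneg by simp
  have int: "integrable L ?k" using km kb by (intro integrable_const_bound[of _ D]) auto
  have int0: "integrable L (\<lambda>s. indicator {s. w s = 0} s * ?k s)"
    by (rule Bochner_Integration.integrable_bound[OF int]) (use km in \<open>auto simp: indicator_def\<close>)
  have int1: "integrable L (\<lambda>s. indicator {s. w s \<noteq> 0} s * ?k s)"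
    by (rule Bochner_Integration.integrable_bound[OF int]) (use km in \<open>auto simp: indicator_def\<close>)
  have "(\<integral>s. ?k s \<partial>L) = (\<integral>s. indicator {s. w s = 0} s * ?k s + indicator {s. w s \<noteq> 0} s * ?k s \<partial>L)"
    by (intro Bochner_Integration.integral_cong) (auto simp: indicator_def)
  also have "\<dots> = (\<integral>s. indicator {s. w s = 0} s * ?k s \<partial>L) + (\<integral>s. indicator {s. w s \<noteq> 0} s * ?k s \<partial>L)"
    by (rule Bochner_Integration.integral_add[OF int0 int1])
  also have "(\<integral>s. indicator {s. w s = 0} s * ?k s \<partial>L) = (\<integral>s. (\<Sum>i<d. z i * (indicator {s. w s = 0} s * slope (t i) s)) \<partial>L)"
    by (intro Bochner_Integration.integral_cong) (auto simp: indicator_def levy_kernel_0_left)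
  also have "\<dots> = (\<Sum>i<d. z i * drift (t i))"
    unfolding drift_def using drift_integrable by (subst Bochner_Integration.integral_sum) auto
  also have "(\<integral>s. indicator {s. w s \<noteq> 0} s * ?k s \<partial>L) =
      (\<integral>x\<in>M0_inf. (1 - exp_minus (\<Sum>i<d. ereal (z i) * x (t i))) \<partial>levy)"
  proof -
    define f where "f x = 1 - exp_minus (\<Sum>i<d. ereal (z i) * x (t i))" for x :: "real \<Rightarrow> ereal"
    have f [measurable]: "f \<in> borel_measurable D_inf_algebra"
      unfolding f_def
      by (intro borel_measurable_diff borel_measurable_const borel_measurable_ereal_sum borel_measurable_ereal_times
          measurable_compose[OF _ measurable_exp_minus] measurable_D_inf_coordinate)
    have [measurable]: "M0_inf \<in> sets D_inf_algebra" by (rule sets_M0_inf)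
    have fM: "(\<lambda>x. indicator M0_inf x *\<^sub>R f x) \<in> borel_measurable D_inf_algebra" by measurable
    have "(\<integral>x\<in>M0_inf. f x \<partial>levy) =
        (\<integral>s. indicator M0_inf (jump_path s) *\<^sub>R f (jump_path s) \<partial>density L (\<lambda>s. ennreal (if jump_path s = (\<lambda>_. 0) then 0 else 1 / w s)))"
      unfolding set_lebesgue_integral_def levy_def by (rule integral_distr[OF _ fM]) simp
    also have "\<dots> = (\<integral>s. (if jump_path s = (\<lambda>_. 0) then 0 else 1 / w s) *\<^sub>R f (jump_path s) \<partial>L)"
      using jump_path_M0_inf w_nonneg by (subst integral_density) auto
    also have "\<dots> = (\<integral>s. indicator {s. w s \<noteq> 0} s * ?k s \<partial>L)"
    proof (rule integral_cong_AE)
      show "(\<lambda>s. (if jump_path s = (\<lambda>_. 0) then 0 else 1 / w s) *\<^sub>R f (jump_path s)) \<in> borel_measurable L"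
        by measurable
      show "(\<lambda>s. indicator {s. w s \<noteq> 0} s * ?k s) \<in> borel_measurable L"
        using km by measurable
      show "AE s in L. (if jump_path s = (\<lambda>_. 0) then 0 else 1 / w s) *\<^sub>R f (jump_path s) = indicator {s. w s \<noteq> 0} s * ?k s"
        using AE_slope_INF[OF vanish] w_y_le
      proof eventually_elim
        case (elim s)
        show ?case
        proof (cases "w s = 0")
          case True
          then show ?thesis by simp
        next
          case False
          then have w: "0 < w s" using w_nonneg[of s] by simp
          then have r: "regular s" using elim by (simp add: regular_def)
          have "w s * ?k s = 1 - (\<Prod>i<d. rpow (z i) (1 - w s * slope (t i) s))"
            using w elim w_slope_le slope_nonneg by (intro levy_kernel_mult) auto
          also have "\<dots> = f (jump_path s)"
            unfolding f_def using z M0_inf_nonneg[OF jump_path_M0_inf]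
            by (subst exp_minus_weighted_sum) (auto simp: exp_minus_path[OF r])
          finally have eq: "w s * ?k s = f (jump_path s)" .
          \<comment> \<open>A regular point may still produce the zero path. Its weight 0 is then
            correct, because the kernel vanishes there as well.\<close>
          show ?thesis
          proof (cases "jump_path s = (\<lambda>_. 0)")
            case True
            then have "f (jump_path s) = 0" by (simp add: f_def)
            then show ?thesis using True eq w by simp
          next
            case False
            then show ?thesis using eq w by (simp add: field_simps)
          qed
        qed
      qed
    qed
    finally show ?thesis by (simp add: f_def)
  qed
  finally show ?thesis .
qed

lemma levy_kernel_integral_limit:
  assumes z: "\<And>i. i < d \<Longrightarrow> 0 \<le> z i"
    and \<kappa>: "\<And>i m. t i < q (\<kappa> i m)" "\<And>i m. q (\<kappa> i m) < t i + 1" "\<And>i. (\<lambda>m. q (\<kappa> i m)) \<longlonglongrightarrow> t i"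
  shows "(\<lambda>m. \<integral>s. levy_kernel d z (w s) (\<lambda>i. y (\<kappa> i m) s) \<partial>L) \<longlonglongrightarrow>
    (\<integral>s. levy_kernel d z (w s) (\<lambda>i. slope (t i) s) \<partial>L)"
proof -
  \<comment> \<open>The bounds \<open>B k\<close> depend on the index; an index beyond
    \<open>t i + 1\<close> dominates all \<open>\<kappa> i m\<close> at once, by monotonicity of
    \<open>y\<close>.\<close>
  have "\<forall>i. \<exists>k. t i + 1 < q k" using slope_index by blast
  from choice[OF this] obtain K where K: "\<And>i. t i + 1 < q (K i)" by blast
  have "\<exists>D. \<forall>w y. (\<forall>i<d. \<bar>y i\<bar> \<le> B (K i)) \<longrightarrow> \<bar>levy_kernel d z w y\<bar> \<le> D"
    by (rule levy_kernel_bounded[OF z])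
  then obtain D where D: "\<forall>w y. (\<forall>i<d. \<bar>y i\<bar> \<le> B (K i)) \<longrightarrow> \<bar>levy_kernel d z w y\<bar> \<le> D"
    by (rule exE)
  show ?thesis
  proof (rule integral_dominated_convergence[where w = "\<lambda>_. D"])
    show "AE s in L. (\<lambda>m. levy_kernel d z (w s) (\<lambda>i. y (\<kappa> i m) s)) \<longlonglongrightarrow> levy_kernel d z (w s) (\<lambda>i. slope (t i) s)"
      using y_mono
    proof eventually_elim
      case (elim s)
      show ?case
        by (intro continuous_levy_kernel tendsto_const slope_limit[OF elim] \<kappa> z)
    qed
    show "AE s in L. norm (levy_kernel d z (w s) (\<lambda>i. y (\<kappa> i m) s)) \<le> D" for m
      using y_mono
    proof eventually_elim
      case (elim s)
      have "\<bar>y (\<kappa> i m) s\<bar> \<le> B (K i)" for i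
      proof -
        have "q (\<kappa> i m) \<le> q (K i)" using \<kappa>(2)[of i m] K[of i] by linarith
        then have "y (\<kappa> i m) s \<le> y (K i) s" using elim by blast
        then show ?thesis using y_le[of "K i" s] y_nonneg[of "\<kappa> i m" s] by linarith
      qed
      then show ?case using D by simp
    qed
    show "(\<lambda>s. levy_kernel d z (w s) (\<lambda>i. slope (t i) s)) \<in> borel_measurable L"
      by (intro measurable_levy_kernel w_measurable slope_measurable)
    show "(\<lambda>s. levy_kernel d z (w s) (\<lambda>i. y (\<kappa> i m) s)) \<in> borel_measurable L" for m
      by (intro measurable_levy_kernel w_measurable y_measurable)
  qed simp
qed

end

section \<open>The representation\<close>

text \<open>A vanishing transform would make some \<open>H (t i)\<close> infinite almost surely,
  with \<open>i\<close> depending on the outcome. By monotonicity \<open>H\<close> would then be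
  almost surely infinite at one time beyond all \<open>t i\<close>.\<close>

lemma laplace_positive:
  fixes d :: nat
  assumes "prob_space M" and [measurable]: "\<And>t. H t \<in> borel_measurable M"
    and nonneg: "\<And>t. AE \<omega> in M. 0 \<le> H t \<omega>"
    and mono: "\<And>s t. s \<le> t \<Longrightarrow> AE \<omega> in M. H s \<omega> \<le> H t \<omega>"
    and fin: "\<And>t. measure M {\<omega> \<in> space M. H t \<omega> = \<infinity>} < 1"
    and z: "\<forall>i<d. 0 \<le> z i"
  shows "0 < (\<integral>\<omega>. exp_minus (\<Sum>i<d. ereal (z i) * H (t i :: real) \<omega>) \<partial>M)"
proof -
  interpret prob_space M by fact
  let ?e = "\<lambda>\<omega>. exp_minus (\<Sum>i<d. ereal (z i) * H (t i) \<omega>)"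
  have all: "AE \<omega> in M. \<forall>i<d. 0 \<le> H (t i) \<omega>" using nonneg by (simp add: AE_all_countable)
  have e: "AE \<omega> in M. 0 \<le> ?e \<omega> \<and> ?e \<omega> \<le> 1"
    using all
  proof eventually_elim
    case (elim \<omega>)
    then have "0 \<le> (\<Sum>i<d. ereal (z i) * H (t i) \<omega>)" using z by (intro sum_nonneg) auto
    then show ?case using exp_minus_bounds by blast
  qed
  have int: "integrable M ?e"
    by (rule integrable_const_bound[of _ 1]) (use e in auto)
  have "0 \<le> integral\<^sup>L M ?e" using e by (intro integral_nonneg_AE) auto
  moreover have "integral\<^sup>L M ?e \<noteq> 0"
  proof
    assume "integral\<^sup>L M ?e = 0"
    then have "AE \<omega> in M. ?e \<omega> = 0"
      using integral_nonneg_eq_0_iff_AE[OF int] e by auto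
    \<comment> \<open>The sum of absolute values serves as an upper bound of all \<open>t i\<close>,
      also for \<open>d = 0\<close>.\<close>
    define T where "T = (\<Sum>i<d. \<bar>t i\<bar>)"
    have T: "t i \<le> T" if "i < d" for i
      using member_le_sum[of i "{..<d}" "\<lambda>i. \<bar>t i\<bar>"] that by (simp add: T_def)
    then have "\<forall>i<d. AE \<omega> in M. H (t i) \<omega> \<le> H T \<omega>" using mono by blast
    then have "AE \<omega> in M. \<forall>i<d. H (t i) \<omega> \<le> H T \<omega>" by (simp add: AE_all_countable)
    with all \<open>AE \<omega> in M. ?e \<omega> = 0\<close> have "AE \<omega> in M. H T \<omega> = \<infinity>"
    proof eventually_elim
      case (elim \<omega>)
      show ?case
      proof (rule ccontr)
        assume T: "H T \<omega> \<noteq> \<infinity>"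
        have "0 < rpow (z i) (exp_minus (H (t i) \<omega>))" if "i < d" for i
        proof -
          have "0 \<le> H (t i) \<omega>" "H (t i) \<omega> \<noteq> \<infinity>" using elim that T by auto
          then have "0 < exp_minus (H (t i) \<omega>)"
            using exp_minus_eq_0_iff[of "H (t i) \<omega>"] exp_minus_bounds(1)[of "H (t i) \<omega>"] by simp
          then show ?thesis by (simp add: rpow_def)
        qed
        then have "0 < (\<Prod>i<d. rpow (z i) (exp_minus (H (t i) \<omega>)))" by (intro prod_pos) auto
        also have "\<dots> = ?e \<omega>" using elim z by (intro exp_minus_weighted_sum[symmetric]) auto
        finally show False using elim by simp
      qed
    qed
    then have "measure M {\<omega> \<in> space M. H T \<omega> = \<infinity>} = 1"
      by (subst prob_Collect_eq_1) auto
    then show False using fin[of T] by simp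
  qed
  ultimately show ?thesis by simp
qed

text \<open>Multiplication in \<open>ereal\<close> is not continuous at
  \<open>0 * \<infinity>\<close>, so the limit is taken in product form, where every factor is a
  continuous function on \<open>[0, 1]\<close>.\<close>

lemma laplace_tendsto:
  fixes d :: nat
  assumes "prob_space M" and [measurable]: "\<And>t. H t \<in> borel_measurable M"
    and nonneg: "\<And>t. AE \<omega> in M. 0 \<le> H t \<omega>"
    and lim: "\<And>i. i < d \<Longrightarrow> AE \<omega> in M. (\<lambda>m. H (\<tau> i m) \<omega>) \<longlonglongrightarrow> X i \<omega>"
    and X [measurable]: "\<And>i. X i \<in> borel_measurable M" and X0: "\<And>i. AE \<omega> in M. 0 \<le> X i \<omega>"
    and z: "\<forall>i<d. 0 \<le> z i"
  shows "(\<lambda>m. \<integral>\<omega>. exp_minus (\<Sum>i<d. ereal (z i) * H (\<tau> i m :: real) \<omega>) \<partial>M)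
    \<longlonglongrightarrow> (\<integral>\<omega>. exp_minus (\<Sum>i<d. ereal (z i) * X i \<omega>) \<partial>M)"
proof -
  interpret prob_space M by fact
  have all: "AE \<omega> in M. \<forall>m. \<forall>i<d. 0 \<le> H (\<tau> i m) \<omega>"
    using nonneg by (simp add: AE_all_countable)
  have allX: "AE \<omega> in M. \<forall>i<d. 0 \<le> X i \<omega>" using X0 by (simp add: AE_all_countable)
  have lim': "AE \<omega> in M. \<forall>i<d. (\<lambda>m. H (\<tau> i m) \<omega>) \<longlonglongrightarrow> X i \<omega>"
    using lim by (simp add: AE_all_countable)
  show ?thesis
  proof (rule integral_dominated_convergence[where w = "\<lambda>_. 1"])
    show "AE \<omega> in M. (\<lambda>m. exp_minus (\<Sum>i<d. ereal (z i) * H (\<tau> i m) \<omega>))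
        \<longlonglongrightarrow> exp_minus (\<Sum>i<d. ereal (z i) * X i \<omega>)"
      using all allX lim'
    proof eventually_elim
      case (elim \<omega>)
      have "(\<lambda>m. rpow (z i) (exp_minus (H (\<tau> i m) \<omega>))) \<longlonglongrightarrow> rpow (z i) (exp_minus (X i \<omega>))" if "i < d" for i
      proof (rule continuous_on_tendsto_compose[OF continuous_rpow])
        show "(\<lambda>m. exp_minus (H (\<tau> i m) \<omega>)) \<longlonglongrightarrow> exp_minus (X i \<omega>)"
          using elim that by (intro exp_minus_tendsto) auto
      qed (use elim z that in \<open>auto simp: exp_minus_bounds\<close>)
      then have "(\<lambda>m. \<Prod>i<d. rpow (z i) (exp_minus (H (\<tau> i m) \<omega>))) \<longlonglongrightarrow> (\<Prod>i<d. rpow (z i) (exp_minus (X i \<omega>)))"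
        by (intro tendsto_prod) auto
      then show ?case using elim z by (simp add: exp_minus_weighted_sum)
    qed
    show "AE \<omega> in M. norm (exp_minus (\<Sum>i<d. ereal (z i) * H (\<tau> i m) \<omega>)) \<le> 1" for m
      using all
    proof eventually_elim
      case (elim \<omega>)
      then have "0 \<le> (\<Sum>i<d. ereal (z i) * H (\<tau> i m) \<omega>)" using z by (intro sum_nonneg) auto
      then show ?case using exp_minus_bounds by simp
    qed
    show "(\<lambda>\<omega>. exp_minus (\<Sum>i<d. ereal (z i) * X i \<omega>)) \<in> borel_measurable M"
      by measurable
    show "(\<lambda>\<omega>. exp_minus (\<Sum>i<d. ereal (z i) * H (\<tau> i m) \<omega>)) \<in> borel_measurable M" for m
      by measurable
  qed simp
qed

theorem proposition2p16:
  fixes M :: "'a measure" and H :: "real \<Rightarrow> 'a \<Rightarrow> ereal"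
  assumes "extended_chronometer M H"
    and "AE \<omega> in M. ((\<lambda>t. H t \<omega>) \<longlongrightarrow> 0) at_bot"
    and "\<forall>t. measure M {\<omega> \<in> space M. H t \<omega> = \<infinity>} < 1"
  shows "\<exists>(\<nu> :: (real \<Rightarrow> ereal) measure) (b :: real \<Rightarrow> real).
           levy_measure_on_M0_inf \<nu> \<and>
           b \<in> D_real \<and> (\<lambda>t. ereal (b t)) \<in> M0_inf \<and>
           (\<forall>(d::nat) (z :: nat \<Rightarrow> real) (t :: nat \<Rightarrow> real). (\<forall>i<d. 0 \<le> z i) \<longrightarrow>
              (\<integral>\<omega>. exp_minus (\<Sum>i<d. ereal (z i) * H (t i) \<omega>) \<partial>M) =
              exp (- (\<Sum>i<d. z i * b (t i))
                   - (\<integral>x\<in>M0_inf. (1 - exp_minus (\<Sum>i<d. ereal (z i) * x (t i))) \<partial>\<nu>)))"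
proof -
  have id: "id_process M H" using assms(1) by (simp add: extended_chronometer_def)
  have H [measurable]: "H t \<in> borel_measurable M" for t
    using id by (simp add: id_process_def stoch_process_def)
  have M: "prob_space M" using id by (simp add: id_process_def stoch_process_def)
  interpret M: prob_space M by (rule M)
  have paths: "AE \<omega> in M. (\<lambda>t. H t \<omega>) \<in> D_inf \<and> (\<forall>t. 0 \<le> H t \<omega>) \<and> mono (\<lambda>t. H t \<omega>)"
    using assms(1) by (simp add: extended_chronometer_def)
  have nonneg: "AE \<omega> in M. 0 \<le> H t \<omega>" for t using paths by eventually_elim auto
  have mono: "AE \<omega> in M. H s \<omega> \<le> H t \<omega>" if "s \<le> t" for s t
    using paths by eventually_elim (use that in \<open>auto simp: mono_def\<close>)
  have pos: "0 < (\<integral>\<omega>. exp_minus (\<Sum>i<d. ereal (z i) * H (t i) \<omega>) \<partial>M)" if "\<forall>i<d. 0 \<le> z i" for d :: nat and z t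
    using M H nonneg mono assms(3)[rule_format] that by (rule laplace_positive)
  obtain q :: "nat \<Rightarrow> real" where q: "\<And>a b. a < b \<Longrightarrow> \<exists>k. a < q k \<and> q k < b"
    by (rule dense_sequence_exists) blast
  obtain L :: "real measure" and w y B where
    L: "prob_space L" "w \<in> borel_measurable L" "\<forall>k. y k \<in> borel_measurable L"
      "\<forall>s. 0 \<le> w s" "\<forall>k s. 0 \<le> y k s" "\<forall>k s. y k s \<le> B k"
      "AE s in L. \<forall>k. w s * y k s \<le> 1"
      "AE s in L. \<forall>k l. q k \<le> q l \<longrightarrow> y k s \<le> y l s"
    and rep: "\<forall>(d::nat) z \<kappa>. (\<forall>i<d. 0 \<le> z i) \<longrightarrow>
      - ln (\<integral>\<omega>. exp_minus (\<Sum>i<d. ereal (z i) * H (q (\<kappa> i)) \<omega>) \<partial>M) =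
      (\<integral>s. levy_kernel d z (w s) (\<lambda>i. y (\<kappa> i) s) \<partial>L)"
    by (rule limit_representation[OF id nonneg mono pos, where q = q]) (assumption | rule that)+
  interpret L: prob_space L by (rule L(1))
  interpret levy_limit L w y B q
    by unfold_locales (use L q in \<open>auto\<close>)

  \<comment> \<open>The margin \<open>1 / Suc m\<close> provides both convergence from the right and
    the bound \<open>t + 1\<close> needed for domination.\<close>
  have "\<exists>\<kappa>. \<forall>m. t < q (\<kappa> m) \<and> q (\<kappa> m) < t + 1 / real (Suc m)" for t
    using q[of t "t + 1 / real (Suc m)" for m] by (intro choice) simp
  then obtain \<kappa> :: "real \<Rightarrow> nat \<Rightarrow> nat" where \<kappa>: "\<And>t m. t < q (\<kappa> t m)" "\<And>t m. q (\<kappa> t m) < t + 1 / real (Suc m)"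
    by metis
  have \<kappa>1: "q (\<kappa> t m) < t + 1" for t m
    using \<kappa>(2)[of t m] by (auto elim!: less_le_trans simp: divide_le_eq)
  have \<kappa>_lim: "(\<lambda>m. q (\<kappa> t m)) \<longlonglongrightarrow> t" for t
  proof (rule tendsto_sandwich[where f = "\<lambda>_. t" and h = "\<lambda>m. t + 1 / real (Suc m)"])
    have "(\<lambda>m. t + 1 / real (Suc m)) \<longlonglongrightarrow> t + 0"
      using LIMSEQ_Suc[OF lim_1_over_n] by (intro tendsto_intros) auto
    then show "(\<lambda>m. t + 1 / real (Suc m)) \<longlonglongrightarrow> t" by simp
  qed (auto intro!: always_eventually less_imp_le[OF \<kappa>(1)] less_imp_le[OF \<kappa>(2)] simp del: of_nat_Suc)
  have \<kappa>_right: "filterlim (\<lambda>m. q (\<kappa> t m)) (at_right t) sequentially" for t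
    using \<kappa>_lim[of t] \<kappa>(1)[of t] by (auto simp: filterlim_at less_imp_neq[THEN not_sym] intro!: always_eventually)

  have exponent: "- ln (\<integral>\<omega>. exp_minus (\<Sum>i<d. ereal (z i) * H (t i) \<omega>) \<partial>M) =
      (\<integral>s. levy_kernel d z (w s) (\<lambda>i. slope (t i) s) \<partial>L)"
    if z: "\<forall>i<d. 0 \<le> z i" for d :: nat and z t :: "nat \<Rightarrow> real"
  proof (rule LIMSEQ_unique)
    have "(\<lambda>m. \<integral>\<omega>. exp_minus (\<Sum>i<d. ereal (z i) * H (q (\<kappa> (t i) m)) \<omega>) \<partial>M)
        \<longlonglongrightarrow> (\<integral>\<omega>. exp_minus (\<Sum>i<d. ereal (z i) * H (t i) \<omega>) \<partial>M)"
    proof (rule laplace_tendsto[OF M H nonneg _ H nonneg z])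
      show "AE \<omega> in M. (\<lambda>m. H (q (\<kappa> (t i) m)) \<omega>) \<longlonglongrightarrow> H (t i) \<omega>" for i
        using paths
      proof eventually_elim
        case (elim \<omega>)
        then have "((\<lambda>t. H t \<omega>) \<longlongrightarrow> H (t i) \<omega>) (at_right (t i))"
          by (simp add: D_inf_def cadlag_def)
        from filterlim_compose[OF this \<kappa>_right] show ?case .
      qed
    qed
    then show "(\<lambda>m. - ln (\<integral>\<omega>. exp_minus (\<Sum>i<d. ereal (z i) * H (q (\<kappa> (t i) m)) \<omega>) \<partial>M))
        \<longlonglongrightarrow> - ln (\<integral>\<omega>. exp_minus (\<Sum>i<d. ereal (z i) * H (t i) \<omega>) \<partial>M)"
      using pos[OF z, of t] by (intro tendsto_minus tendsto_ln) auto
    have "(\<lambda>m. \<integral>s. levy_kernel d z (w s) (\<lambda>i. y (\<kappa> (t i) m) s) \<partial>L)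
        \<longlonglongrightarrow> (\<integral>s. levy_kernel d z (w s) (\<lambda>i. slope (t i) s) \<partial>L)"
      using z \<kappa>(1) \<kappa>1 \<kappa>_lim by (intro levy_kernel_integral_limit[where \<kappa> = "\<lambda>i. \<kappa> (t i)"]) auto
    then show "(\<lambda>m. - ln (\<integral>\<omega>. exp_minus (\<Sum>i<d. ereal (z i) * H (q (\<kappa> (t i) m)) \<omega>) \<partial>M))
        \<longlonglongrightarrow> (\<integral>s. levy_kernel d z (w s) (\<lambda>i. slope (t i) s) \<partial>L)"
      using rep[rule_format, of d z "\<lambda>i. \<kappa> (t i) m" for m] z by simp
  qed

  \<comment> \<open>The case of one time and \<open>z = 1\<close>, in which the kernel is the slope;
    it transfers the behaviour of \<open>H\<close> at minus infinity to the slopes.\<close>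
  have slope_integral: "(\<integral>s. slope t s \<partial>L) = - ln (\<integral>\<omega>. exp_minus (\<Sum>i<1::nat. ereal 1 * H t \<omega>) \<partial>M)" for t
    using exponent[of 1 "\<lambda>_. 1" "\<lambda>_. t"] unfolding levy_kernel_single by simp
  have vanish: "(\<lambda>n. \<integral>s. slope (- real n) s \<partial>L) \<longlonglongrightarrow> 0"
  proof -
    have "(\<lambda>m. \<integral>\<omega>. exp_minus (\<Sum>i<1::nat. ereal 1 * H (- real m) \<omega>) \<partial>M)
        \<longlonglongrightarrow> (\<integral>\<omega>. exp_minus (\<Sum>i<1::nat. ereal 1 * 0) \<partial>M)"
    proof (rule laplace_tendsto[OF M H nonneg])
      show "AE \<omega> in M. (\<lambda>m. H (- real m) \<omega>) \<longlonglongrightarrow> 0"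
        using assms(2) by eventually_elim (rule filterlim_compose[OF _ real_seq_at_bot])
    qed auto
    then have "(\<lambda>m. - ln (\<integral>\<omega>. exp_minus (\<Sum>i<1::nat. ereal 1 * H (- real m) \<omega>) \<partial>M)) \<longlonglongrightarrow> - ln 1"
      by (intro tendsto_minus tendsto_ln) (auto simp: M.prob_space)
    then show ?thesis by (simp only: slope_integral ln_one minus_zero)
  qed

  have "(\<integral>\<omega>. exp_minus (\<Sum>i<d. ereal (z i) * H (t i) \<omega>) \<partial>M) =
      exp (- (\<Sum>i<d. z i * drift (t i))
        - (\<integral>x\<in>M0_inf. (1 - exp_minus (\<Sum>i<d. ereal (z i) * x (t i))) \<partial>levy))"
    if z: "\<forall>i<d. 0 \<le> z i" for d :: nat and z t :: "nat \<Rightarrow> real"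
  proof -
    have "- ln (\<integral>\<omega>. exp_minus (\<Sum>i<d. ereal (z i) * H (t i) \<omega>) \<partial>M) = (\<Sum>i<d. z i * drift (t i))
        + (\<integral>x\<in>M0_inf. (1 - exp_minus (\<Sum>i<d. ereal (z i) * x (t i))) \<partial>levy)"
      unfolding exponent[OF z] using z by (intro levy_kernel_integral_split vanish) auto
    then have "ln (\<integral>\<omega>. exp_minus (\<Sum>i<d. ereal (z i) * H (t i) \<omega>) \<partial>M) = - (\<Sum>i<d. z i * drift (t i))
        - (\<integral>x\<in>M0_inf. (1 - exp_minus (\<Sum>i<d. ereal (z i) * x (t i))) \<partial>levy)"
      by linarith
    then show ?thesis using exp_ln[OF pos[OF z, of t]] by simp
  qed
  then show ?thesis
    using levy_measure_levy drift_properties[OF vanish]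
    by (intro exI[of _ levy] exI[of _ drift]) simp
qed

end
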